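(* Let $B$ be a $p$-uniformly smooth Banach space with norm $\|\cdot\|_B$, for some $p\in(1,2]$. Let $G:B\to B$ be a function such that the equation $G(x)=0$ has a unique solution $x^*\in B$, and suppose there are constants $0<\rho<1$ and $1\le\theta<\infty$ with $$\|\theta^{-1}G(x)-(x-x^* )\|_B\le\rho\|x-x^*\|_B\quad\text{for all }x\in B.$$ For $n\ge 0$ let $\lambda_n:B^{n+1}\to\mathbb R$ be functions such that for some constant $C<\infty$, $$|\lambda_n(u_0,\dots,u_n)|\le C\bigl(1+\max_{0\le k\le n}\|u_k\|_B\bigr)\quad\text{for all }n\ge 0,\ u_0,\dots,u_n\in B.$$ Let $\{\alpha_n:n\ge 0\}$ be a sequence of constants in $(0,1)$ with $\lim_n\alpha_n=0$ and $\sum_{n=0}^\infty\alpha_n=\infty$. Let $\{Z_n:n\ge 0\}$ be a sequence of $B$-valued random variables on a probability space $(\Omega,\mathcal F,\mathbb P)$. Suppose that $$\sum_{n=0}^\infty\mathbb P(\|\alpha_nZ_{n+1}\|_B\ge 1)<\infty,$$ and that, writing $\overline Z_{n+1}=\mathbb E[Z_{n+1}\mathbf 1_{\{\|\alpha_nZ_{n+1}\|_B<1\}}\mid\sigma(Z_j:j\le n)]$, there are sequences of constants $\{\mu_n:n\ge 0\}$ and $\{\sigma_n^2:n\ge 0\}$ such that for all $n\ge 0$ $$\mathbb E\bigl[\|\overline Z_{n+1}\|_B\bigr]\le\mu_n,\qquad \mathbb E\bigl[\|Z_{n+1}\mathbf 1_{\{\|\alpha_nZ_{n+1}\|_B<1\}}-\overline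 Z_{n+1}\|_B^2\bigr]\le\sigma_n^2,$$ and $$\sum_{n=0}^\infty\alpha_n\mu_n<\infty,\qquad \sum_{n=0}^\infty\alpha_n^p\sigma_n^p<\infty.$$ Fix $y_0\in B$ and define $Y_0=y_0$ and $$Y_{n+1}=Y_n-\alpha_n\bigl(G(Y_n)+\lambda_n(Y_0,\dots,Y_n)Z_{n+1}\bigr),\quad n\ge 0.$$ Then $\{Y_{n+1}:n\ge 0\}$ converges to $x^*$ almost surely.
   Context: A Banach space $B$ is $p$-uniformly smooth ($1<p\le 2$) if there is a constant $0<D<\infty$ such that $\|x+y\|_B^p+\|x-y\|_B^p\le 2\|x\|_B^p+D\|y\|_B^p$ for all $x,y\in B$. Here $\sigma_n\ge 0$ denotes the square root of $\sigma_n^2$, $\sigma(Z_j:j\le n)$ is the $\sigma$-field generated by $Z_0,\dots,Z_n$, $\mathbf 1_A$ is the indicator of $A$, and conditional expectations of $B$-valued random variables are taken in the Bochner sense. Convergence is in the norm $\|\cdot\|_B$.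
   Formalization: For each n, the coefficient λ_n(Y_0,…,Y_n) is additionally assumed to be measurable with respect to σ(Z_j : j ≤ n); for arbitrary non-measurable functions λ_n the claim can fail. *)

theory Defs
  imports "HOL-Probability.Probability"
begin

definition uniformly_smooth :: "real \<Rightarrow> 'b::real_normed_vector itself \<Rightarrow> bool" where
  "uniformly_smooth p (_ :: 'b itself) \<longleftrightarrow>
     1 < p \<and> p \<le> 2 \<and>
     (\<exists>D>0. \<forall>x y :: 'b. norm (x + y) powr p + norm (x - y) powr p
                        \<le> 2 * norm x powr p + D * norm y powr p)"

(* The library's has_bochner_integral requires a second countable value space.
   This is the same definition without that restriction: approximability by simple
   functions already forces f to be almost surely separably valued. *)
definition has_bochner_int :: "'a measure \<Rightarrow> ('a \<Rightarrow> 'b::real_normed_vector) \<Rightarrow> 'b \<Rightarrow> bool" where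
  "has_bochner_int M f I \<longleftrightarrow>
     f \<in> borel_measurable M \<and>
     (\<exists>s. (\<forall>i. Bochner_Integration.simple_bochner_integrable M (s i)) \<and>
          (\<lambda>i. \<integral>\<^sup>+x. norm (f x - s i x) \<partial>M) \<longlonglongrightarrow> 0 \<and>
          (\<lambda>i. Bochner_Integration.simple_bochner_integral M (s i)) \<longlonglongrightarrow> I)"

lemma has_bochner_int_iff_has_bochner_integral:
  fixes f :: "'a \<Rightarrow> 'b::{real_normed_vector, second_countable_topology}"
  shows "has_bochner_int M f I \<longleftrightarrow> has_bochner_integral M f I"
  unfolding has_bochner_int_def has_bochner_integral.simps by blast

(* W is a version of the conditional expectation of X given F. Taking A = space M shows
   that X and W are both Bochner integrable with respect to M. *)
definition is_cond_exp ::
  "'a measure \<Rightarrow> 'a measure \<Rightarrow> ('a \<Rightarrow> 'b::real_normed_vector) \<Rightarrow> ('a \<Rightarrow> 'b) \<Rightarrow> bool" where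
  "is_cond_exp M F X W \<longleftrightarrow>
     subalgebra M F \<and> W \<in> borel_measurable F \<and>
     (\<forall>A\<in>sets F. \<exists>I. has_bochner_int M (\<lambda>\<omega>. indicator A \<omega> *\<^sub>R X \<omega>) I \<and>
                    has_bochner_int M (\<lambda>\<omega>. indicator A \<omega> *\<^sub>R W \<omega>) I)"

definition sigma_upto ::
  "'a measure \<Rightarrow> (nat \<Rightarrow> 'a \<Rightarrow> 'b::topological_space) \<Rightarrow> nat \<Rightarrow> 'a measure" where
  "sigma_upto M Z n =
     sigma (space M) (\<Union>j\<le>n. {Z j -` A \<inter> space M | A. A \<in> sets borel})"

definition truncated ::
  "'a measure \<Rightarrow> (nat \<Rightarrow> real) \<Rightarrow> (nat \<Rightarrow> 'a \<Rightarrow> 'b::real_normed_vector) \<Rightarrow> nat \<Rightarrow> 'a \<Rightarrow> 'b" where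
  "truncated M \<alpha> Z n \<omega> =
     indicator {\<omega>\<in>space M. norm (\<alpha> n *\<^sub>R Z (Suc n) \<omega>) < 1} \<omega> *\<^sub>R Z (Suc n) \<omega>"

lemma space_sigma_upto [simp]: "space (sigma_upto M Z n) = space M"
  unfolding sigma_upto_def by (rule space_measure_of) auto

lemma measurable_sigma_upto:
  assumes "j \<le> n"
  shows "Z j \<in> borel_measurable (sigma_upto M Z n)"
proof (rule measurableI)
  fix A assume "A \<in> sets (borel :: 'b measure)"
  then show "Z j -` A \<inter> space (sigma_upto M Z n) \<in> sets (sigma_upto M Z n)"
    unfolding space_sigma_upto unfolding sigma_upto_def
    using assms by (subst sets_measure_of) (auto intro!: sigma_sets.Basic)
qed simp

(* For separable B, Borel measurability of G and of the lambda_n makes the coefficients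
   lambda_n(Y_0, ..., Y_n) adapted to the filtration generated by Z. *)
lemma coefficients_adapted:
  fixes G :: "'b::{banach, second_countable_topology} \<Rightarrow> 'b"
    and lam :: "nat \<Rightarrow> (nat \<Rightarrow> 'b) \<Rightarrow> real" and Y Z :: "nat \<Rightarrow> 'a \<Rightarrow> 'b"
  assumes G: "G \<in> borel_measurable borel"
    and lam: "\<And>n. lam n \<in> borel_measurable (Pi\<^sub>M {..n} (\<lambda>_. borel))"
    and Y0: "\<And>\<omega>. \<omega> \<in> space M \<Longrightarrow> Y 0 \<omega> = y0"
    and Y_Suc: "\<And>n \<omega>. \<omega> \<in> space M \<Longrightarrow> Y (Suc n) \<omega> = Y n \<omega> -
          \<alpha> n *\<^sub>R (G (Y n \<omega>) + lam n (\<lambda>k\<in>{..n}. Y k \<omega>) *\<^sub>R Z (Suc n) \<omega>)"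
  shows "(\<lambda>\<omega>. lam n (\<lambda>k\<in>{..n}. Y k \<omega>)) \<in> borel_measurable (sigma_upto M Z n)"
proof -
  have lamY: "(\<lambda>\<omega>. lam k (\<lambda>i\<in>{..k}. Y i \<omega>)) \<in> borel_measurable (sigma_upto M Z n)"
    if "\<And>i. i \<le> k \<Longrightarrow> Y i \<in> borel_measurable (sigma_upto M Z n)" for k
    by (rule measurable_compose[OF measurable_restrict lam]) (use that in auto)
  have "Y k \<in> borel_measurable (sigma_upto M Z n)" if "k \<le> n" for k
    using that
  proof (induction k rule: less_induct)
    case (less k)
    show ?case
    proof (cases k)
      case 0
      show ?thesis unfolding 0
        by (subst measurable_cong[where g = "\<lambda>_. y0"]) (auto simp: Y0)
    next
      case (Suc m)
      have [measurable]: "(\<lambda>\<omega>. lam m (\<lambda>i\<in>{..m}. Y i \<omega>)) \<in> borel_measurable (sigma_upto M Z n)"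
        "Y m \<in> borel_measurable (sigma_upto M Z n)"
        using less Suc by (auto intro!: lamY)
      have [measurable]: "Z (Suc m) \<in> borel_measurable (sigma_upto M Z n)"
        using less Suc by (intro measurable_sigma_upto) auto
      note [measurable] = G
      show ?thesis unfolding Suc
        by (subst measurable_cong[OF Y_Suc]) (simp, measurable)
    qed
  qed
  then show ?thesis by (intro lamY) auto
qed

end

theory Submission
  imports Defs
begin

text \<open>Write \<open>e n = Y n - x_star\<close>, let \<open>\<Lambda> n\<close> be the running maximum of \<open>1\<close> and the
  \<open>\<bar>\<lambda> k\<bar>\<close> with \<open>k \<le> n\<close>, and let \<open>c n = \<lambda> n / \<Lambda> n\<close>, which is adapted and bounded by \<open>1\<close>. If the noise
  series \<open>\<Sum>n. (\<alpha> n * c n) *\<^sub>R Z (Suc n)\<close> converges along a path, then summation by parts against the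
  monotone weights \<open>\<Lambda>\<close> first bounds \<open>\<Lambda>\<close>, hence \<open>e\<close>, and then gives \<open>e n \<longlonglongrightarrow> 0\<close>, since the drift
  contracts. The noise series converges almost surely: the untruncated part is eventually zero by
  Borel-Cantelli, the conditional means are absolutely summable, and the rest is a martingale
  transform whose increments have summable \<open>p\<close>-th moments, so that uniform smoothness bounds the
  \<open>p\<close>-th moments of its partial sums and a maximal inequality makes it a Cauchy sequence.\<close>

text \<open>The obstacle is circular: convergence of the noise series asks for controlled
  multipliers, but \<open>lam n\<close> is controlled only through the path, which is not yet known
  to be bounded. Dividing by \<open>\<Lambda> n\<close> breaks the circle: the multipliers
  \<open>c n\<close> lie in [-1, 1] whatever the path does, so the probabilistic half makes no
  reference to the size of \<open>Y\<close>. The deterministic half closes the loop. Linear growth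
  of \<open>lam\<close> gives \<Lambda> \<le> const * (1 + max of norm e), while small tails of a
  convergent series give norm e \<le> const + small * \<Lambda>; together these bound \<Lambda>,
  with the small factor chosen according to the growth constant. A second obstacle is that B may be
  nonseparable, where sums and integrals of Borel functions misbehave. Truncated noise and
  conditional mean are therefore replaced by strongly measurable versions before they are
  subtracted, and centering is passed on as an inequality between integrals of norms.\<close>

section \<open>Deterministic recursions\<close>

lemma prod_one_minus_tendsto_0:
  fixes b :: "nat \<Rightarrow> real"
  assumes "\<And>n. 0 \<le> b n" "\<And>n. b n \<le> 1" "\<not> summable b"
  shows "(\<lambda>n. \<Prod>k<n. 1 - b k) \<longlonglongrightarrow> 0"
proof (rule tendsto_sandwich[OF _ _ tendsto_const])
  show "(\<lambda>n. exp (- (\<Sum>k<n. b k))) \<longlonglongrightarrow> 0"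
  proof (rule filterlim_compose[OF exp_at_bot])
    have "filterlim (\<lambda>n. \<Sum>k<n. b k) at_top sequentially"
      unfolding filterlim_at_top
    proof (rule allI)
      fix r :: real
      obtain N where N: "r < (\<Sum>k<N. b k)"
        using assms(1,3) summableI_nonneg_bounded[of b r] by (meson not_le)
      have "r \<le> (\<Sum>k<n. b k)" if "n \<ge> N" for n
        using sum_mono2[of "{..<n}" "{..<N}" b] assms(1) N that by fastforce
      then show "\<forall>\<^sub>F n in sequentially. r \<le> (\<Sum>k<n. b k)"
        by (auto simp: eventually_sequentially)
    qed
    then show "filterlim (\<lambda>n. - (\<Sum>k<n. b k)) at_bot sequentially"
      by (simp add: filterlim_uminus_at_bot)
  qed
  show "\<forall>\<^sub>F n in sequentially. (\<Prod>k<n. 1 - b k) \<le> exp (- (\<Sum>k<n. b k))"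
  proof (rule always_eventually, rule allI)
    fix n
    have "(\<Prod>k<n. 1 - b k) \<le> (\<Prod>k<n. exp (- b k))"
      using assms(2) exp_ge_add_one_self[of "- b k" for k] by (intro prod_mono) auto
    then show "(\<Prod>k<n. 1 - b k) \<le> exp (- (\<Sum>k<n. b k))"
      by (simp add: exp_sum sum_negf[symmetric])
  qed
  show "\<forall>\<^sub>F n in sequentially. 0 \<le> (\<Prod>k<n. 1 - b k)"
    using assms(2) by (intro always_eventually allI prod_nonneg) auto
qed

text \<open>The weights \<open>1 - b n\<close> and \<open>b n\<close> form a convex combination, so
  a level \<open>r / 4\<close> that dominates \<open>\<epsilon>\<close> is preserved by the
  iteration. The summable errors \<open>\<eta>\<close> merely accumulate to a small tail, and the
  initial value is damped by the product of the \<open>1 - b n\<close>, which vanishes because the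
  sum of \<open>b\<close> diverges.\<close>

lemma perturbed_contraction_tendsto_0:
  fixes x b \<epsilon> \<eta> :: "nat \<Rightarrow> real"
  assumes b: "\<And>n. 0 \<le> b n" "\<And>n. b n \<le> 1" "\<not> summable b"
    and eps: "\<epsilon> \<longlonglongrightarrow> 0" and eta: "\<And>n. 0 \<le> \<eta> n" "summable \<eta>"
    and x: "\<And>n. 0 \<le> x n" "\<And>n. x (Suc n) \<le> (1 - b n) * x n + b n * \<epsilon> n + \<eta> n"
  shows "x \<longlonglongrightarrow> 0"
proof (rule LIMSEQ_I)
  fix r :: real assume r: "0 < r"
  obtain N1 where N1: "\<And>n. n \<ge> N1 \<Longrightarrow> \<bar>\<epsilon> n\<bar> < r / 4"
    using LIMSEQ_D[OF eps, of "r / 4"] r by auto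
  obtain N2 where N2: "\<And>n. norm (\<Sum>i. \<eta> (i + N2)) < r / 4" 
    using LIMSEQ_D[OF suminf_exist_split2[OF eta(2)], of "r / 4"] r by auto
  define N where "N = max N1 N2"
  define P where "P n = (\<Prod>k<n. 1 - b (k + N))" for n
  have P: "P \<longlonglongrightarrow> 0"
    unfolding P_def by (rule prod_one_minus_tendsto_0) (use b summable_iff_shift[of b N] in auto)
  have P_nonneg: "0 \<le> P n" for n
    unfolding P_def using b(2) by (intro prod_nonneg) auto
  have main: "x (n + N) \<le> r / 4 + (\<Sum>k<n. \<eta> (k + N)) + P n * x N" for n
  proof (induction n)
    case 0
    then show ?case using r by (simp add: P_def)
  next
    case (Suc n)
    have "x (Suc n + N) \<le> (1 - b (n + N)) * x (n + N) + b (n + N) * \<epsilon> (n + N) + \<eta> (n + N)"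
      using x(2)[of "n + N"] by simp
    also have "\<dots> \<le> (1 - b (n + N)) * (r / 4 + (\<Sum>k<n. \<eta> (k + N)) + P n * x N)
        + b (n + N) * (r / 4) + \<eta> (n + N)"
      using abs_ge_self[of "\<epsilon> (n + N)"] N1[of "n + N", unfolded N_def] b Suc
      by (intro add_mono mult_left_mono order_refl) (auto simp: N_def max_def split: if_splits)
    also have "\<dots> = r / 4 + (1 - b (n + N)) * (\<Sum>k<n. \<eta> (k + N)) + P (Suc n) * x N + \<eta> (n + N)"
      by (simp add: P_def field_simps)
    also have "\<dots> \<le> r / 4 + 1 * (\<Sum>k<n. \<eta> (k + N)) + P (Suc n) * x N + \<eta> (n + N)"
      using b eta by (intro add_mono mult_right_mono sum_nonneg order_refl) auto
    finally show ?case by simp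
  qed
  have "(\<Sum>k<n. \<eta> (k + N)) \<le> r / 4" for n
  proof -
    have sm: "summable (\<lambda>k. \<eta> (k + N2))" using eta by (simp add: summable_iff_shift)
    \<comment> \<open>\<open>N\<close> may exceed \<open>N2\<close>, so the sum is read as a block
      of the tail that starts at \<open>N2\<close>.\<close>
    have "(\<Sum>k<n. \<eta> (k + N)) = (\<Sum>k\<in>(\<lambda>k. k + (N - N2)) ` {..<n}. \<eta> (k + N2))"
      by (subst sum.reindex) (auto simp: inj_on_def N_def)
    also have "\<dots> \<le> (\<Sum>k. \<eta> (k + N2))"
      using eta by (intro sum_le_suminf sm) auto
    finally show ?thesis using N2 by (auto simp: abs_if split: if_splits)
  qed
  note S = this
  have "(\<lambda>n. P n * x N) \<longlonglongrightarrow> 0" using tendsto_mult_left_zero[OF P] .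
  then obtain K where K: "\<And>n. n \<ge> K \<Longrightarrow> \<bar>P n * x N\<bar> < r / 4"
    using LIMSEQ_D[of "\<lambda>n. P n * x N" 0 "r / 4"] r by auto
  show "\<exists>no. \<forall>n\<ge>no. norm (x n - 0) < r"
  proof (intro exI allI impI)
    fix n assume n: "n \<ge> K + N"
    have "K \<le> n - N" using n by simp
    then show "norm (x n - 0) < r"
      using main[of "n - N"] S[of "n - N"] K[of "n - N"] x(1)[of n] n r
      by (auto simp: abs_if split: if_splits)
  qed
qed

text \<open>Summation by parts: \<open>f n = e n - \<Lambda> n *\<^sub>R T n\<close>, where \<open>T\<close> is the tail of the noise series,
  absorbs the noise, and \<open>f\<close> is contracted up to errors that are small relative to \<open>\<Lambda>\<close>.\<close>

lemma stochastic_approximation_pathwise: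
  fixes e g w :: "nat \<Rightarrow> 'b::real_normed_vector" and a \<Lambda> c :: "nat \<Rightarrow> real"
  assumes rho: "0 < \<rho>" "\<rho> < 1"
    and a: "\<And>n. 0 < a n" "a \<longlonglongrightarrow> 0" "\<not> summable a"
    and g: "\<And>n. norm (g n - e n) \<le> \<rho> * norm (e n)"
    and e: "\<And>n. e (Suc n) = e n - a n *\<^sub>R g n - \<Lambda> n *\<^sub>R w n"
    and Lam: "\<And>n. 0 \<le> \<Lambda> n" "mono \<Lambda>"
    and bound: "\<And>n. \<Lambda> n \<le> C * (1 + Max ((\<lambda>k. norm (e k)) ` {..n}))"
    and w: "summable w"
  shows "e \<longlonglongrightarrow> 0"
proof -
  define T where "T n = (\<Sum>k. w (k + n))" for n
  define f where "f n = e n - \<Lambda> n *\<^sub>R T n" for n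
  have T0: "T \<longlonglongrightarrow> 0"
    unfolding T_def by (rule suminf_exist_split2[OF w])
  have T_Suc: "w n = T n - T (Suc n)" for n
  proof -
    have "summable (\<lambda>k. w (k + n))" using w by (simp add: summable_iff_shift)
    from suminf_split_head[OF this] show ?thesis by (simp add: T_def)
  qed
  \<comment> \<open>With \<open>w n = T n - T (Suc n)\<close> the noise survives only as a tail
    times \<open>a n * \<Lambda> n\<close>, a perturbation on the scale of the drift, and as a tail
    times an increment of \<open>\<Lambda>\<close>, which telescopes.\<close>
  have f_Suc: "f (Suc n) = (1 - a n) *\<^sub>R f n - a n *\<^sub>R (g n - e n)
      - (a n * \<Lambda> n) *\<^sub>R T n - (\<Lambda> (Suc n) - \<Lambda> n) *\<^sub>R T (Suc n)" for n
    unfolding f_def e[of n] T_Suc[of n] by (simp add: algebra_simps)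
  have Lam_Suc: "\<Lambda> n \<le> \<Lambda> (Suc n)" for n using monoD[OF Lam(2), of n "Suc n"] by simp
  have e_le: "norm (e n) \<le> norm (f n) + \<Lambda> n * norm (T n)" for n
    using norm_triangle_ineq[of "f n" "\<Lambda> n *\<^sub>R T n"] Lam(1)[of n] by (simp add: f_def)
  \<comment> \<open>The drift contracts \<open>e\<close>, not \<open>f\<close>; passing from one to
    the other costs \<open>\<rho> * a n * \<Lambda> n * norm (T n)\<close>, and \<rho> \<le> 1
    merges this with the tail term already present. Hence the factor 2.\<close>
  have contract: "norm (f (Suc n)) \<le> (1 - a n * (1 - \<rho>)) * norm (f n)
      + 2 * a n * \<Lambda> n * norm (T n) + (\<Lambda> (Suc n) - \<Lambda> n) * norm (T (Suc n))"
    if "a n < 1" for n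
  proof -
    have "norm (f (Suc n)) \<le> norm ((1 - a n) *\<^sub>R f n) + norm (a n *\<^sub>R (g n - e n))
        + norm ((a n * \<Lambda> n) *\<^sub>R T n) + norm ((\<Lambda> (Suc n) - \<Lambda> n) *\<^sub>R T (Suc n))"
      unfolding f_Suc by (intro order_trans[OF norm_triangle_ineq4] add_mono order_refl)
    also have "\<dots> = (1 - a n) * norm (f n) + a n * norm (g n - e n)
        + a n * \<Lambda> n * norm (T n) + (\<Lambda> (Suc n) - \<Lambda> n) * norm (T (Suc n))"
      using that a(1)[of n] Lam(1)[of n] Lam_Suc[of n] by simp
    also have "a n * norm (g n - e n) \<le> a n * (\<rho> * (norm (f n) + \<Lambda> n * norm (T n)))"
      using g[of n] e_le[of n] a(1)[of n] rho
      by (intro mult_left_mono) (auto intro: order_trans mult_left_mono)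
    also have "a n * (\<rho> * (norm (f n) + \<Lambda> n * norm (T n)))
        \<le> a n * \<rho> * norm (f n) + a n * \<Lambda> n * norm (T n)"
      using rho a(1)[of n] Lam(1)[of n] 
        mult_right_mono[of \<rho> 1 "a n * (\<Lambda> n * norm (T n))"] by (simp add: algebra_simps)
    finally show ?thesis by (simp add: algebra_simps)
  qed
  have "\<forall>\<^sub>F n in sequentially. a n < 1" using a(2) by (rule order_tendstoD) simp
  then obtain N0 where N0: "\<And>n. n \<ge> N0 \<Longrightarrow> a n < 1" by (auto simp: eventually_sequentially)
  \<comment> \<open>The induction for \<open>f_bound\<close> needs two things:
    \<open>K * (1 - \<rho>) \<ge> 2\<close>, so that the contraction pays for the noise term with
    factor 2, and \<open>K \<ge> 1\<close>, so that growth of \<open>\<Lambda>\<close> pays for the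
    increment term.\<close>
  define K where "K = 1 + 2 / (1 - \<rho>)"
  have "K * (1 - \<rho>) = (1 - \<rho>) + 2" using rho by (simp add: K_def field_simps)
  then have K: "1 \<le> K" "2 \<le> K * (1 - \<rho>)" using rho by (auto simp: K_def)
  \<comment> \<open>Makes the coefficient of \<open>\<Lambda> n\<close> at most 1/2 when the bound
    on \<open>e\<close> is inserted into \<open>bound\<close>, so that it can be absorbed on the
    left.\<close>
  define \<delta> where "\<delta> = 1 / (2 * (\<bar>C\<bar> + 1)) / (K + 1)"
  have delta: "0 < \<delta>" "\<bar>C\<bar> * ((K + 1) * \<delta>) \<le> 1 / 2"
  proof -
    show "0 < \<delta>" unfolding \<delta>_def using K by (intro divide_pos_pos mult_pos_pos) auto
    have "(K + 1) * \<delta> = 1 / (2 * (\<bar>C\<bar> + 1))" using K by (simp add: \<delta>_def)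
    then show "\<bar>C\<bar> * ((K + 1) * \<delta>) \<le> 1 / 2" by (simp add: divide_le_eq)
  qed
  obtain N1 where N1: "\<And>n. n \<ge> N1 \<Longrightarrow> norm (T n) < \<delta>"
    using LIMSEQ_D[OF T0 delta(1)] by auto
  \<comment> \<open>Beyond \<open>N\<close> both the steps are below 1, as \<open>contract\<close>
    requires, and the tails are below \<open>\<delta>\<close>. Early steps are allowed to exceed
    1.\<close>
  define N where "N = max N0 N1"
  have f_bound: "norm (f n) \<le> norm (f N) + K * \<delta> * \<Lambda> n" if "n \<ge> N" for n
    using that
  proof (induction n rule: dec_induct)
    case base
    then show ?case using K delta Lam(1)[of N] by simp
  next
    case (step n)
    have an: "a n < 1" and Tn: "norm (T n) \<le> \<delta>" "norm (T (Suc n)) \<le> \<delta>"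
      using step.hyps N0[of n] N1[of n] N1[of "Suc n"] by (auto simp: N_def)
    have a1: "0 \<le> 1 - a n * (1 - \<rho>)"
      using an a(1)[of n] rho mult_mono[of "a n" 1 "1 - \<rho>" 1] by auto
    have "norm (f (Suc n)) \<le> (1 - a n * (1 - \<rho>)) * norm (f n)
      + 2 * a n * \<Lambda> n * norm (T n) + (\<Lambda> (Suc n) - \<Lambda> n) * norm (T (Suc n))"
      by (rule contract[OF an])
    also have "\<dots> \<le> (1 - a n * (1 - \<rho>)) * (norm (f N) + K * \<delta> * \<Lambda> n)
      + 2 * a n * \<Lambda> n * \<delta> + (\<Lambda> (Suc n) - \<Lambda> n) * \<delta>"
      using a(1)[of n] Lam(1)[of n] Lam_Suc[of n]
      by (intro add_mono mult_left_mono a1 step.IH Tn) auto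
    also have "\<dots> \<le> norm (f N) + K * \<delta> * \<Lambda> (Suc n)"
    proof -
      have "0 \<le> a n * (1 - \<rho>) * norm (f N)" "0 \<le> a n * \<delta> * \<Lambda> n * (K * (1 - \<rho>) - 2)"
        "0 \<le> (K - 1) * \<delta> * (\<Lambda> (Suc n) - \<Lambda> n)"
        using a(1)[of n] rho delta K Lam(1)[of n] Lam_Suc[of n] by (auto intro!: mult_nonneg_nonneg)
      then show ?thesis by (simp add: algebra_simps)
    qed
    finally show ?case .
  qed
  \<comment> \<open>Covers the initial segment, which \<open>f_bound\<close> does not reach. The
    bound on \<open>e k\<close> below is stated with \<open>\<Lambda> n\<close> for every k \<le> n,
    so that it passes to the maximum in \<open>bound\<close>.\<close>
  define E where "E = Max ((\<lambda>k. norm (e k)) ` {..N})"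
  have E: "norm (e k) \<le> E" if "k \<le> N" for k
    unfolding E_def using that by (intro Max_ge) auto
  have E0: "0 \<le> E" using E[of 0] norm_ge_zero[of "e 0"] by linarith
  have e_bound: "norm (e k) \<le> E + norm (f N) + (K + 1) * \<delta> * \<Lambda> n" if "k \<le> n" for k n
  proof (cases "k \<le> N")
    case True
    have "0 \<le> (K + 1) * \<delta> * \<Lambda> n" using K delta Lam(1)[of n] by simp
    then show ?thesis using E[OF True] by (smt (verit) norm_ge_zero)
  next
    case False
    have "norm (e k) \<le> norm (f N) + K * \<delta> * \<Lambda> k + \<Lambda> k * \<delta>"
    proof -
      have k: "N \<le> k" "N1 \<le> k" using False by (auto simp: N_def)
      show ?thesis
        using e_le[of k] f_bound[OF k(1)] N1[OF k(2)] Lam(1)[of k]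
          mult_left_mono[of "norm (T k)" \<delta> "\<Lambda> k"] by linarith
    qed
    also have "\<dots> = norm (f N) + (K + 1) * \<delta> * \<Lambda> k" by (simp add: algebra_simps)
    also have "\<dots> \<le> norm (f N) + (K + 1) * \<delta> * \<Lambda> n"
      using monoD[OF Lam(2) that] K delta by (intro add_mono mult_left_mono) auto
    finally show ?thesis using E0 by linarith
  qed
  \<comment> \<open>The factor 2 comes from moving half of \<open>\<Lambda> n\<close> to the
    left.\<close>
  define L where "L = 2 * (\<bar>C\<bar> * (1 + (E + norm (f N))))"
  have L: "\<Lambda> n \<le> L" for n
  proof -
    define m where "m = Max ((\<lambda>k. norm (e k)) ` {..n})"
    have m: "m \<le> E + norm (f N) + (K + 1) * \<delta> * \<Lambda> n"
      unfolding m_def by (subst Max_le_iff) (auto intro: e_bound)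
    have m0: "0 \<le> m" unfolding m_def by (subst Max_ge_iff) auto
    have "\<Lambda> n \<le> C * (1 + m)" using bound[of n] by (simp add: m_def)
    also have "\<dots> \<le> \<bar>C\<bar> * (1 + m)" using m0 by (intro mult_right_mono) auto
    also have "\<dots> \<le> \<bar>C\<bar> * (1 + (E + norm (f N) + (K + 1) * \<delta> * \<Lambda> n))"
      using m by (intro mult_left_mono) auto
    also have "\<dots> = \<bar>C\<bar> * (1 + (E + norm (f N))) + \<bar>C\<bar> * ((K + 1) * \<delta>) * \<Lambda> n"
      by (simp add: algebra_simps)
    also have "\<dots> \<le> \<bar>C\<bar> * (1 + (E + norm (f N))) + 1 / 2 * \<Lambda> n"
      using delta Lam(1)[of n] by (intro add_left_mono mult_right_mono)
    finally show ?thesis by (simp add: L_def)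
  qed
  have Lam_conv: "convergent \<Lambda>"
    using Lam(2) L Lam(1) by (intro Bseq_mono_convergent) (auto simp: mono_def intro!: BseqI'[of _ L])
  then obtain l where l: "\<Lambda> \<longlonglongrightarrow> l" by (auto simp: convergent_def)
  have LT: "(\<lambda>n. \<Lambda> n * norm (T n)) \<longlonglongrightarrow> 0"
    using tendsto_mult[OF l tendsto_norm[OF T0]] by simp
  have TN: "norm (T (Suc (n + N))) < \<delta>" for n by (rule N1) (simp add: N_def)
  have aN: "a (n + N) < 1" for n by (rule N0) (simp add: N_def)
  \<comment> \<open>Now that \<open>\<Lambda>\<close> converges, the tail term has the form
    \<open>b n * \<epsilon> n\<close> with \<open>b n = a n * (1 - \<rho>)\<close> and \<epsilon>
    tending to 0 (hence the division by \<open>1 - \<rho>\<close>), and the increments of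
    \<open>\<Lambda>\<close> are summable and serve as \<open>\<eta>\<close>.\<close>
  have "(\<lambda>n. norm (f (n + N))) \<longlonglongrightarrow> 0"
  proof (rule perturbed_contraction_tendsto_0)
    show "0 \<le> a (n + N) * (1 - \<rho>)" for n using a(1)[of "n + N"] rho by simp
    show "a (n + N) * (1 - \<rho>) \<le> 1" for n
      using a(1)[of "n + N"] less_imp_le[OF aN[of n]] rho mult_mono[of "a (n + N)" 1 "1 - \<rho>" 1]
      by auto
    show "\<not> summable (\<lambda>n. a (n + N) * (1 - \<rho>))"
    proof
      assume "summable (\<lambda>n. a (n + N) * (1 - \<rho>))"
      from summable_mult2[OF this, of "1 / (1 - \<rho>)"] show False
        using a(3) rho by (simp add: summable_iff_shift)
    qed
    show "(\<lambda>n. 2 * (\<Lambda> (n + N) * norm (T (n + N))) / (1 - \<rho>)) \<longlonglongrightarrow> 0"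
      using tendsto_divide[OF tendsto_mult[OF tendsto_const[of 2] LIMSEQ_ignore_initial_segment[OF LT, of N]] 
          tendsto_const[of "1 - \<rho>"]] rho by simp
    show "0 \<le> (\<Lambda> (Suc (n + N)) - \<Lambda> (n + N)) * \<delta>" for n
      using Lam_Suc[of "n + N"] delta by simp
    show "summable (\<lambda>n. (\<Lambda> (Suc (n + N)) - \<Lambda> (n + N)) * \<delta>)"
      using telescope_summable[OF LIMSEQ_ignore_initial_segment[OF l, of N]]
      by (intro summable_mult2) simp
    show "norm (f (Suc n + N)) \<le> (1 - a (n + N) * (1 - \<rho>)) * norm (f (n + N)) +
         a (n + N) * (1 - \<rho>) * (2 * (\<Lambda> (n + N) * norm (T (n + N))) / (1 - \<rho>)) +
         (\<Lambda> (Suc (n + N)) - \<Lambda> (n + N)) * \<delta>" for n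
    proof -
      have "(\<Lambda> (Suc (n + N)) - \<Lambda> (n + N)) * norm (T (Suc (n + N)))
          \<le> (\<Lambda> (Suc (n + N)) - \<Lambda> (n + N)) * \<delta>"
        using Lam_Suc[of "n + N"] less_imp_le[OF TN[of n]] by (intro mult_left_mono) auto
      then show ?thesis using contract[OF aN[of n]] rho by simp
    qed
  qed auto
  then have "(\<lambda>n. norm (f n)) \<longlonglongrightarrow> 0" by (rule LIMSEQ_offset)
  then have "(\<lambda>n. norm (f n) + \<Lambda> n * norm (T n)) \<longlonglongrightarrow> 0"
    using tendsto_add[OF _ LT] by force
  then show ?thesis
    by (rule Lim_null_comparison[rotated]) (simp add: e_le)
qed

section \<open>Strong measurability without separability\<close>

text \<open>Since \<open>B\<close> need not be separable, sums of Borel measurable functions need not be Borel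
  measurable; strong measurability is the notion that is stable under the vector operations.\<close>

definition strongly_measurable :: "'a measure \<Rightarrow> ('a \<Rightarrow> 'b::real_normed_vector) \<Rightarrow> bool" where
  "strongly_measurable F f \<longleftrightarrow>
     (\<exists>s. (\<forall>i. simple_function F (s i)) \<and> (\<forall>x\<in>space F. (\<lambda>i. s i x) \<longlonglongrightarrow> f x))"

lemma strongly_measurable_borel:
  assumes "strongly_measurable F f"
  shows "f \<in> borel_measurable F"
proof -
  obtain s where "\<And>i. simple_function F (s i)" "\<And>x. x \<in> space F \<Longrightarrow> (\<lambda>i. s i x) \<longlonglongrightarrow> f x"
    using assms unfolding strongly_measurable_def by blast
  then show ?thesis
    by (rule borel_measurable_LIMSEQ_metric[of s F f, OF borel_measurable_simple_function])
qed

lemma strongly_measurable_norm: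
  assumes "strongly_measurable F f"
  shows "(\<lambda>x. norm (f x)) \<in> borel_measurable F"
  using measurable_compose[OF strongly_measurable_borel[OF assms]
      borel_measurable_continuous_onI[OF continuous_on_norm_id]] .

lemma strongly_measurable_const: "strongly_measurable F (\<lambda>_. c)"
  unfolding strongly_measurable_def by (intro exI[of _ "\<lambda>_ _. c"]) auto

lemma strongly_measurable_real:
  fixes f :: "'a \<Rightarrow> real"
  assumes "f \<in> borel_measurable F"
  shows "strongly_measurable F f"
  using borel_measurable_implies_sequence_metric[OF assms] unfolding strongly_measurable_def by blast

lemma strongly_measurable_add:
  assumes "strongly_measurable F f" "strongly_measurable F g"
  shows "strongly_measurable F (\<lambda>x. f x + g x)"
proof -
  obtain s where s: "\<And>i. simple_function F (s i)" "\<And>x. x \<in> space F \<Longrightarrow> (\<lambda>i. s i x) \<longlonglongrightarrow> f x"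
    using assms(1) unfolding strongly_measurable_def by blast
  obtain t where t: "\<And>i. simple_function F (t i)" "\<And>x. x \<in> space F \<Longrightarrow> (\<lambda>i. t i x) \<longlonglongrightarrow> g x"
    using assms(2) unfolding strongly_measurable_def by blast
  show ?thesis unfolding strongly_measurable_def
    by (intro exI[of _ "\<lambda>i x. s i x + t i x"] conjI allI ballI tendsto_add s t
        simple_function_compose2[where h = "(+)"])
qed

lemma strongly_measurable_scaleR:
  assumes "h \<in> borel_measurable F" "strongly_measurable F g"
  shows "strongly_measurable F (\<lambda>x. h x *\<^sub>R g x)"
proof -
  obtain s where s: "\<And>i. simple_function F (s i)" "\<And>x. x \<in> space F \<Longrightarrow> (\<lambda>i. s i x) \<longlonglongrightarrow> h x"
    using strongly_measurable_real[OF assms(1)] unfolding strongly_measurable_def by blast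
  obtain t where t: "\<And>i. simple_function F (t i)" "\<And>x. x \<in> space F \<Longrightarrow> (\<lambda>i. t i x) \<longlonglongrightarrow> g x"
    using assms(2) unfolding strongly_measurable_def by blast
  show ?thesis unfolding strongly_measurable_def
    by (intro exI[of _ "\<lambda>i x. s i x *\<^sub>R t i x"] conjI allI ballI tendsto_scaleR s t
        simple_function_compose2[where h = "(*\<^sub>R)"])
qed

lemma strongly_measurable_diff:
  assumes "strongly_measurable F f" "strongly_measurable F g"
  shows "strongly_measurable F (\<lambda>x. f x - g x)"
  using strongly_measurable_add[OF assms(1) strongly_measurable_scaleR[of "\<lambda>_. - 1", OF _ assms(2)]]
  by simp

lemma strongly_measurable_sum:
  assumes "\<And>i. i \<in> I \<Longrightarrow> strongly_measurable F (f i)"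
  shows "strongly_measurable F (\<lambda>x. \<Sum>i\<in>I. f i x)"
  using assms
  by (induction I rule: infinite_finite_induct)
    (auto intro: strongly_measurable_const strongly_measurable_add)

lemma simple_function_subalgebra:
  assumes "subalgebra M F" "simple_function F f"
  shows "simple_function M f"
  using assms by (auto simp: simple_function_def subalgebra_def)

lemma strongly_measurable_subalgebra:
  assumes "subalgebra M F" "strongly_measurable F f"
  shows "strongly_measurable M f"
proof -
  obtain s where s: "\<And>i. simple_function F (s i)" "\<And>x. x \<in> space F \<Longrightarrow> (\<lambda>i. s i x) \<longlonglongrightarrow> f x"
    using assms(2) unfolding strongly_measurable_def by blast
  have "space F = space M" using assms(1) by (simp add: subalgebra_def)
  with s show ?thesis unfolding strongly_measurable_def
    by (intro exI[of _ s] conjI allI ballI simple_function_subalgebra[OF assms(1)]) auto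
qed

text \<open>Approximants larger than twice the norm of the limit are reset to 0. Where
  \<open>f x\<close> is nonzero this happens only finitely often, since
  \<open>norm (f x) < 2 * norm (f x)\<close>; where it vanishes the new sequence is constantly 0.
  The bound supplies the majorant for dominated convergence.\<close>

lemma strongly_measurable_dominated_approx:
  assumes "strongly_measurable F f"
  obtains s where "\<And>i. simple_function F (s i)" "\<And>x. x \<in> space F \<Longrightarrow> (\<lambda>i. s i x) \<longlonglongrightarrow> f x"
    "\<And>i x. norm (s i x) \<le> 2 * norm (f x)"
proof -
  obtain t where t: "\<And>i. simple_function F (t i)" "\<And>x. x \<in> space F \<Longrightarrow> (\<lambda>i. t i x) \<longlonglongrightarrow> f x"
    using assms unfolding strongly_measurable_def by blast
  have [measurable]: "(\<lambda>x. norm (f x)) \<in> borel_measurable F" "(\<lambda>x. norm (t i x)) \<in> borel_measurable F" for i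
    by (rule strongly_measurable_norm[OF assms],
        rule borel_measurable_simple_function[OF simple_function_compose1[OF t(1)]])
  define s where "s i x = (if norm (t i x) \<le> 2 * norm (f x) then t i x else 0)" for i x
  show thesis
  proof (rule that)
    show "simple_function F (s i)" for i
      unfolding s_def by (intro simple_function_If t(1)) auto
    show "norm (s i x) \<le> 2 * norm (f x)" for i x by (simp add: s_def)
    fix x assume x: "x \<in> space F"
    show "(\<lambda>i. s i x) \<longlonglongrightarrow> f x"
    proof (cases "f x = 0")
      case True
      then show ?thesis by (simp add: s_def if_distrib cong: if_cong)
    next
      case False
      then have "norm (f x) < 2 * norm (f x)" by simp
      from order_tendstoD(2)[OF tendsto_norm[OF t(2)[OF x]] this]
      have "\<forall>\<^sub>F i in sequentially. t i x = s i x"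
        by eventually_elim (simp add: s_def)
      then show ?thesis by (rule Lim_transform_eventually[OF t(2)[OF x]])
    qed
  qed
qed

text \<open>The approximant of order \<open>N\<close> is a point nearest to \<open>f x\<close> among
  the first \<open>N + 1\<close> elements of an enumeration of \<open>D\<close>. It is decided by
  comparing real-valued distances, which are measurable whatever the space.\<close>

lemma strongly_measurable_separable:
  assumes f: "f \<in> borel_measurable F"
    and D: "countable D" "D \<noteq> {}" "\<And>x. x \<in> space F \<Longrightarrow> f x \<in> closure D"
  shows "strongly_measurable F f"
proof -
  define e where "e = from_nat_into D"
  have e: "D = range e" using D by (simp add: e_def range_from_nat_into)
  have [measurable]: "(\<lambda>x. norm (f x - e j)) \<in> borel_measurable F" for j
    by (rule measurable_compose[OF f, of "\<lambda>z. norm (z - e j)"])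
      (intro borel_measurable_continuous_onI continuous_intros)
  \<comment> \<open>\<open>LEAST\<close> breaks ties measurably, and the restriction to k \<le> N
    makes the range finite.\<close>
  define k where "k N x = (LEAST k. k \<le> N \<and> (\<forall>j\<in>{..N}. norm (f x - e k) \<le> norm (f x - e j)))" for N x
  have k: "k N x \<le> N \<and> (\<forall>j\<in>{..N}. norm (f x - e (k N x)) \<le> norm (f x - e j))" for N x
  proof -
    define P where "P k \<longleftrightarrow> k \<le> N \<and> (\<forall>j\<in>{..N}. norm (f x - e k) \<le> norm (f x - e j))" for k
    have "\<exists>k. P k"
    proof -
      let ?S = "(\<lambda>j. norm (f x - e j)) ` {..N}"
      have "Min ?S \<in> ?S" by (intro Min_in) auto
      then obtain k where "k \<in> {..N}" "Min ?S = norm (f x - e k)" by (auto simp only: image_iff)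
      moreover have "Min ?S \<le> norm (f x - e j)" if "j \<in> {..N}" for j
        using that by (intro Min_le) auto
      ultimately have "P k" by (simp add: P_def)
      then show ?thesis ..
    qed
    then have "P (Least P)" by (rule LeastI_ex)
    moreover have "k N x = Least P" unfolding k_def P_def ..
    ultimately show ?thesis by (auto simp: P_def)
  qed
  have [measurable]: "k N \<in> measurable F (count_space UNIV)" for N
    unfolding k_def by measurable
  show ?thesis unfolding strongly_measurable_def
  proof (intro exI[of _ "\<lambda>N x. e (k N x)"] conjI allI ballI)
    fix N
    have "(\<lambda>x. e (k N x)) ` space F \<subseteq> e ` {..N}" using k by auto
    then have "finite ((\<lambda>x. e (k N x)) ` space F)" by (rule finite_subset) simp
    then show "simple_function F (\<lambda>x. e (k N x))"
      unfolding simple_function_eq_measurable by simp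
  next
    fix x assume x: "x \<in> space F"
    show "(\<lambda>N. e (k N x)) \<longlonglongrightarrow> f x"
    proof (rule LIMSEQ_I)
      fix r :: real assume "0 < r"
      then obtain j where j: "norm (f x - e j) < r"
        using D(3)[OF x] unfolding closure_approachable e
        by (auto simp: dist_norm norm_minus_commute)
      show "\<exists>no. \<forall>n\<ge>no. norm (e (k n x) - f x) < r"
      proof (intro exI allI impI)
        fix n assume "j \<le> n"
        then have "norm (f x - e (k n x)) \<le> norm (f x - e j)" using k[of n x] by auto
        then show "norm (e (k n x) - f x) < r" using j by (simp add: norm_minus_commute)
      qed
    qed
  qed
qed

text \<open>A difference of Borel functions is problematic in a nonseparable space, but
  \<open>s\<close> has finitely many values, and for each fixed value the distance is a continuous
  function of \<open>f\<close>.\<close>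

lemma borel_measurable_norm_diff_simple:
  fixes f :: "'a \<Rightarrow> 'b::real_normed_vector"
  assumes f: "f \<in> borel_measurable M" and s: "simple_function M s"
  shows "(\<lambda>x. norm (f x - s x)) \<in> borel_measurable M"
proof (rule measurable_compose_countable'[where g = s and I = "s ` space M" and f = "\<lambda>y x. norm (f x - y)"])
  show "s \<in> measurable M (count_space (s ` space M))"
    using s by (auto simp: simple_function_eq_measurable measurable_def)
  show "countable (s ` space M)" using s by (simp add: simple_functionD(1) countable_finite)
  show "(\<lambda>x. norm (f x - y)) \<in> borel_measurable M" for y
    by (rule measurable_compose[OF f, of "\<lambda>z. norm (z - y)"])
      (intro borel_measurable_continuous_onI continuous_intros)
qed

text \<open>The set where all approximants stay at distance at least \<open>1 / Suc n\<close> from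
  \<open>f\<close> is null by Markov's inequality and convergence in mean. Off these null sets
  \<open>f\<close> is a limit point of the countable set of approximant values.\<close>

lemma has_bochner_int_AE_separable:
  fixes f :: "'a \<Rightarrow> 'b::real_normed_vector"
  assumes "has_bochner_int M f I"
  obtains D where "countable D" "0 \<in> D" "AE x in M. f x \<in> closure D"
proof -
  obtain s where f: "f \<in> borel_measurable M"
    and s: "\<And>i. Bochner_Integration.simple_bochner_integrable M (s i)"
    and lim: "(\<lambda>i. \<integral>\<^sup>+x. norm (f x - s i x) \<partial>M) \<longlonglongrightarrow> 0"
    using assms unfolding has_bochner_int_def by blast
  have sf: "simple_function M (s i)" for i using s[of i] by (auto elim: simple_bochner_integrable.cases)
  \<comment> \<open>The value 0 is added because it becomes the default of the strongly measurable
    modification.\<close>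
  define D where "D = insert 0 (\<Union>i. s i ` space M)"
  have [measurable]: "(\<lambda>x. norm (f x - s i x)) \<in> borel_measurable M" for i
    by (rule borel_measurable_norm_diff_simple[OF f sf])
  have "AE x in M. \<exists>i. norm (f x - s i x) < 1 / Suc n" for n
  proof -
    define A where "A = {x\<in>space M. \<forall>i. 1 / Suc n \<le> norm (f x - s i x)}"
    have [measurable]: "A \<in> sets M" unfolding A_def by measurable
    have "ennreal (1 / Suc n) * emeasure M A \<le> (\<integral>\<^sup>+x. norm (f x - s i x) \<partial>M)" for i
    proof -
      have "ennreal (1 / Suc n) * emeasure M A = (\<integral>\<^sup>+x. ennreal (1 / Suc n) * indicator A x \<partial>M)"
        by (simp add: nn_integral_cmult_indicator)
      also have "\<dots> \<le> (\<integral>\<^sup>+x. norm (f x - s i x) \<partial>M)"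
        by (intro nn_integral_mono) (auto simp: A_def indicator_def intro!: ennreal_leI)
      finally show ?thesis .
    qed
    then have "ennreal (1 / Suc n) * emeasure M A \<le> 0"
      using lim by (intro LIMSEQ_le_const) auto
    then have "emeasure M A = 0" by simp
    then have "A \<in> null_sets M" by auto
    then show ?thesis by (rule AE_I') (auto simp: A_def not_less)
  qed
  then have "AE x in M. \<forall>n. \<exists>i. norm (f x - s i x) < 1 / Suc n" by (simp add: AE_all_countable)
  then have "AE x in M. f x \<in> closure D"
  proof (rule AE_mp, intro AE_I2 impI)
    fix x assume x: "x \<in> space M" and h: "\<forall>n. \<exists>i. norm (f x - s i x) < 1 / Suc n"
    show "f x \<in> closure D" unfolding closure_approachable
    proof (intro allI impI)
      fix r :: real assume "0 < r"
      then obtain n where "1 / Suc n < r" using nat_approx_posE by blast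
      with h obtain i where "norm (f x - s i x) < r" by (meson order.strict_trans)
      then show "\<exists>y\<in>D. dist y (f x) < r"
        using x by (intro bexI[of _ "s i x"]) (auto simp: D_def dist_norm norm_minus_commute)
    qed
  qed
  moreover have "countable D"
    unfolding D_def
    by (intro countable_insert countable_UN countable_finite[OF simple_functionD(1)[OF sf]]) simp
  ultimately show thesis using that[of D] by (auto simp: D_def)
qed

text \<open>The exceptional set is the preimage under \<open>f\<close> of the complement of a closed
  set, hence lies in \<open>F\<close>. Resetting \<open>f\<close> to 0 there keeps measurability
  with respect to \<open>F\<close> and not only to \<open>M\<close>, so adaptedness
  survives.\<close>

lemma strongly_measurable_modification:
  fixes f :: "'a \<Rightarrow> 'b::real_normed_vector"
  assumes F: "subalgebra M F" and f: "f \<in> borel_measurable F"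
    and int: "has_bochner_int M f I"
  obtains f' where "strongly_measurable F f'" "AE x in M. f' x = f x"
proof -
  obtain D where D: "countable D" "0 \<in> D" "AE x in M. f x \<in> closure D"
    using has_bochner_int_AE_separable[OF int] .
  define f' where "f' x = (if f x \<in> closure D then f x else 0)" for x
  have [measurable]: "{x\<in>space F. f x \<in> closure D} \<in> sets F"
    using measurable_sets[OF f, of "closure D"] by (simp add: vimage_def Int_def conj_commute)
  have "f' \<in> borel_measurable F"
    unfolding f'_def using f by (intro measurable_If) auto
  then have "strongly_measurable F f'"
    using D closure_subset by (intro strongly_measurable_separable[of _ _ D]) (auto simp: f'_def)
  moreover have "AE x in M. f' x = f x" using D(3) by eventually_elim (simp add: f'_def)
  ultimately show thesis by (rule that)
qed

section \<open>Conditional centering and Jensen's inequality\<close>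

text \<open>What is used of \<open>E[\<xi> | F] = 0\<close>, namely \<open>norm (x * P A + E[\<xi>; A]) = norm x * P A\<close> for \<open>A \<in> F\<close>,
  in a form that needs no vector-valued integral.\<close>

definition conditionally_centered :: "'a measure \<Rightarrow> 'a measure \<Rightarrow> ('a \<Rightarrow> 'b::real_normed_vector) \<Rightarrow> bool" where
  "conditionally_centered M F \<xi> \<longleftrightarrow>
     (\<forall>A\<in>sets F. \<forall>x. ennreal (norm x) * emeasure M A \<le> (\<integral>\<^sup>+\<omega>\<in>A. ennreal (norm (x + \<xi> \<omega>)) \<partial>M))"

text \<open>Homogeneity: the definition is applied to \<open>x /\<^sub>R c\<close>. Negative
  \<open>c\<close> are included, which is what turns a lower bound for \<open>x + y\<close> into one
  for \<open>x - y\<close>.\<close>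

lemma conditionally_centered_scaleR:
  assumes c: "conditionally_centered M F \<xi>" and F: "subalgebra M F"
    and \<xi>: "strongly_measurable M \<xi>" and A: "A \<in> sets F"
  shows "ennreal (norm x) * emeasure M A \<le> (\<integral>\<^sup>+\<omega>\<in>A. ennreal (norm (x + c *\<^sub>R \<xi> \<omega>)) \<partial>M)"
proof (cases "c = 0")
  case True
  have "A \<in> sets M" using A F by (auto simp: subalgebra_def)
  then show ?thesis using True by (simp add: nn_integral_cmult_indicator)
next
  case False
  have [measurable]: "A \<in> sets M" using A F by (auto simp: subalgebra_def)
  have [measurable]: "(\<lambda>\<omega>. norm (x /\<^sub>R c + \<xi> \<omega>)) \<in> borel_measurable M"
    by (intro strongly_measurable_norm strongly_measurable_add strongly_measurable_const \<xi>)
  have eq: "x + c *\<^sub>R \<xi> \<omega> = c *\<^sub>R (x /\<^sub>R c + \<xi> \<omega>)" for \<omega> using False by (simp add: scaleR_add_right)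
  have "ennreal (norm x) * emeasure M A = ennreal \<bar>c\<bar> * (ennreal (norm (x /\<^sub>R c)) * emeasure M A)"
    using False by (simp add: mult.assoc[symmetric] ennreal_mult[symmetric])
  also have "\<dots> \<le> ennreal \<bar>c\<bar> * (\<integral>\<^sup>+\<omega>\<in>A. ennreal (norm (x /\<^sub>R c + \<xi> \<omega>)) \<partial>M)"
    by (intro mult_left_mono c[unfolded conditionally_centered_def, rule_format, OF A]) simp
  also have "\<dots> = (\<integral>\<^sup>+\<omega>\<in>A. ennreal (norm (x + c *\<^sub>R \<xi> \<omega>)) \<partial>M)"
    unfolding eq by (simp add: nn_integral_cmult[symmetric] ennreal_mult mult.assoc)
  finally show ?thesis .
qed

text \<open>The power lies above its tangent at \<open>u\<close>, here in the form of Young's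
  inequality with exponents p and p / (p - 1). It converts a bound on first moments into one on p-th
  moments.\<close>

lemma powr_ge_tangent:
  fixes t u p :: real
  assumes "1 < p" "0 \<le> t" "0 \<le> u"
  shows "p * u powr (p - 1) * t \<le> t powr p + (p - 1) * u powr p"
proof -
  have "t * u powr (p - 1) \<le> t powr p / p + (u powr (p - 1)) powr (p / (p - 1)) / (p / (p - 1))"
    using assms by (intro Youngs_inequality) (auto simp: field_simps)
  also have "(u powr (p - 1)) powr (p / (p - 1)) = u powr p"
    using assms by (simp add: powr_powr)
  finally show ?thesis using assms by (simp add: field_simps)
qed

text \<open>The tangent at \<open>norm x\<close> is integrated over \<open>A\<close>, with centering
  bounding the linear term from below. The constant term is finite, so it cancels in
  \<open>ennreal\<close> even if the right-hand integral is infinite.\<close>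

lemma (in prob_space) conditional_Jensen_on_set:
  assumes p: "1 < p" and c: "conditionally_centered M F \<xi>" and F: "subalgebra M F"
    and \<xi>: "strongly_measurable M \<xi>" and A: "A \<in> sets F"
  shows "ennreal (norm x powr p) * emeasure M A \<le> (\<integral>\<^sup>+\<omega>\<in>A. ennreal (norm (x + c *\<^sub>R \<xi> \<omega>) powr p) \<partial>M)"
proof -
  have [measurable]: "A \<in> sets M" using A F by (auto simp: subalgebra_def)
  define t where "t \<omega> = norm (x + c *\<^sub>R \<xi> \<omega>)" for \<omega>
  define u where "u = norm x"
  define P where "P = measure M A"
  have P: "emeasure M A = ennreal P" by (simp add: P_def emeasure_eq_measure)
  have [measurable]: "t \<in> borel_measurable M" unfolding t_def
    by (intro strongly_measurable_norm strongly_measurable_add strongly_measurable_const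
        strongly_measurable_scaleR \<xi>) simp
  have u0: "0 \<le> u" "0 \<le> t \<omega>" "0 \<le> P" for \<omega> by (simp_all add: u_def t_def P_def)
  have "ennreal (p * u powr p) * ennreal P = ennreal (p * u powr (p - 1)) * (ennreal u * emeasure M A)"
  proof -
    have "p * u powr p = p * u powr (p - 1) * u"
      using p u0 powr_mult_base[of u "p - 1"] by (simp add: mult.commute)
    then show ?thesis using p u0 by (simp add: P ennreal_mult[symmetric] mult.assoc)
  qed
  also have "\<dots> \<le> ennreal (p * u powr (p - 1)) * (\<integral>\<^sup>+\<omega>\<in>A. ennreal (t \<omega>) \<partial>M)"
    unfolding u_def t_def by (intro mult_left_mono conditionally_centered_scaleR[OF c F \<xi> A]) simp
  also have "\<dots> = (\<integral>\<^sup>+\<omega>\<in>A. ennreal (p * u powr (p - 1) * t \<omega>) \<partial>M)"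
    using p u0 by (simp add: nn_integral_cmult[symmetric] ennreal_mult mult.assoc)
  also have "\<dots> \<le> (\<integral>\<^sup>+\<omega>\<in>A. ennreal (t \<omega> powr p + (p - 1) * u powr p) \<partial>M)"
    by (intro nn_integral_mono mult_right_mono ennreal_leI powr_ge_tangent p u0) simp
  also have "\<dots> = (\<integral>\<^sup>+\<omega>\<in>A. ennreal (t \<omega> powr p) \<partial>M) + (\<integral>\<^sup>+\<omega>\<in>A. ennreal ((p - 1) * u powr p) \<partial>M)"
    using p by (simp add: nn_integral_add[symmetric] ennreal_plus distrib_right)
  also have "(\<integral>\<^sup>+\<omega>\<in>A. ennreal ((p - 1) * u powr p) \<partial>M) = ennreal ((p - 1) * u powr p * P)"
    using p u0 by (simp add: nn_integral_cmult_indicator P ennreal_mult)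
  finally have "ennreal (p * u powr p * P)
      \<le> (\<integral>\<^sup>+\<omega>\<in>A. ennreal (t \<omega> powr p) \<partial>M) + ennreal ((p - 1) * u powr p * P)"
    using p u0 by (simp add: ennreal_mult)
  moreover have "ennreal (p * u powr p * P) = ennreal (u powr p * P) + ennreal ((p - 1) * u powr p * P)"
  proof -
    have "p * u powr p * P = u powr p * P + (p - 1) * u powr p * P" by (simp add: algebra_simps)
    then show ?thesis using p u0 by (simp add: ennreal_plus)
  qed
  ultimately have "ennreal (u powr p * P) \<le> (\<integral>\<^sup>+\<omega>\<in>A. ennreal (t \<omega> powr p) \<partial>M)"
    by (simp add: add.commute[of _ "ennreal ((p - 1) * u powr p * P)"] ennreal_add_left_cancel_le)
  then show ?thesis using u0 by (simp add: P ennreal_mult u_def t_def)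
qed

lemma nn_integral_simple_partition:
  assumes h: "simple_function M h" and f: "f \<in> borel_measurable M"
  shows "(\<integral>\<^sup>+\<omega>. f \<omega> \<partial>M) = (\<Sum>y\<in>h ` space M. \<integral>\<^sup>+\<omega>\<in>h -` {y} \<inter> space M. f \<omega> \<partial>M)"
proof -
  have fin: "finite (h ` space M)" using h by (rule simple_functionD(1))
  have [measurable]: "h -` {y} \<inter> space M \<in> sets M" for y using h by (rule simple_functionD(2))
  have "(\<Sum>y\<in>h ` space M. \<integral>\<^sup>+\<omega>\<in>h -` {y} \<inter> space M. f \<omega> \<partial>M)
      = (\<integral>\<^sup>+\<omega>. (\<Sum>y\<in>h ` space M. f \<omega> * indicator (h -` {y} \<inter> space M) \<omega>) \<partial>M)"
    using f by (intro nn_integral_sum[symmetric]) simp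
  also have "\<dots> = (\<integral>\<^sup>+\<omega>. f \<omega> \<partial>M)"
  proof (rule nn_integral_cong)
    fix \<omega> assume w: "\<omega> \<in> space M"
    have "(\<Sum>y\<in>h ` space M. f \<omega> * indicator (h -` {y} \<inter> space M) \<omega>)
        = (\<Sum>y\<in>h ` space M. if y = h \<omega> then f \<omega> else 0)"
      using w by (intro sum.cong) (auto simp: indicator_def)
    also have "\<dots> = f \<omega>" using w fin by simp
    finally show "(\<Sum>y\<in>h ` space M. f \<omega> * indicator (h -` {y} \<inter> space M) \<omega>) = f \<omega>" .
  qed
  finally show ?thesis ..
qed

text \<open>The level sets of the pair \<open>(S, g)\<close> belong to \<open>F\<close>, and on each
  of them both functions are constants, so the inequality on sets applies piece by piece.\<close>

lemma (in prob_space) conditional_Jensen_simple: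
  fixes S \<xi> :: "'a \<Rightarrow> 'b::real_normed_vector" and g :: "'a \<Rightarrow> real"
  assumes p: "1 < p" and c: "conditionally_centered M F \<xi>" and F: "subalgebra M F"
    and \<xi>: "strongly_measurable M \<xi>" and S: "simple_function F S" and g: "simple_function F g"
  shows "(\<integral>\<^sup>+\<omega>. ennreal (norm (S \<omega>) powr p) \<partial>M) \<le> (\<integral>\<^sup>+\<omega>. ennreal (norm (S \<omega> + g \<omega> *\<^sub>R \<xi> \<omega>) powr p) \<partial>M)"
proof -
  define h where "h \<omega> = (S \<omega>, g \<omega>)" for \<omega>
  have hF: "simple_function F h" unfolding h_def using S g by (rule simple_function_Pair)
  have sp: "space F = space M" using F by (simp add: subalgebra_def)
  have hM: "simple_function M h" "simple_function M S" "simple_function M g"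
    using simple_function_subalgebra[OF F] hF S g by auto
  have "strongly_measurable M S" "strongly_measurable M g"
    using hM unfolding strongly_measurable_def by (auto intro: exI[of _ "\<lambda>_. S"] exI[of _ "\<lambda>_. g"])
  note sm = this strongly_measurable_borel[OF this(2)]
  have [measurable]: "(\<lambda>\<omega>. norm (S \<omega>)) \<in> borel_measurable M"
    "(\<lambda>\<omega>. norm (S \<omega> + g \<omega> *\<^sub>R \<xi> \<omega>)) \<in> borel_measurable M"
    by (intro strongly_measurable_norm strongly_measurable_add strongly_measurable_scaleR sm \<xi>)+
  have m: "(\<lambda>\<omega>. ennreal (norm (S \<omega>) powr p)) \<in> borel_measurable M"
    "(\<lambda>\<omega>. ennreal (norm (S \<omega> + g \<omega> *\<^sub>R \<xi> \<omega>) powr p)) \<in> borel_measurable M" by measurable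
  show ?thesis
    unfolding nn_integral_simple_partition[OF hM(1) m(1)] nn_integral_simple_partition[OF hM(1) m(2)]
  proof -
    show "(\<Sum>y\<in>h ` space M. \<integral>\<^sup>+\<omega>\<in>h -` {y} \<inter> space M. ennreal (norm (S \<omega>) powr p) \<partial>M)
      \<le> (\<Sum>y\<in>h ` space M. \<integral>\<^sup>+\<omega>\<in>h -` {y} \<inter> space M. ennreal (norm (S \<omega> + g \<omega> *\<^sub>R \<xi> \<omega>) powr p) \<partial>M)"
    proof (rule sum_mono)
      fix y assume "y \<in> h ` space M"
      obtain x c where y: "y = (x, c)" by (cases y)
      define A where "A = h -` {y} \<inter> space M"
      have A: "A \<in> sets F" using simple_functionD(2)[OF hF, of "{y}"] by (simp add: A_def sp)
      then have [measurable]: "A \<in> sets M" using F by (auto simp: subalgebra_def)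
      have "(\<integral>\<^sup>+\<omega>\<in>A. ennreal (norm (S \<omega>) powr p) \<partial>M) = (\<integral>\<^sup>+\<omega>\<in>A. ennreal (norm x powr p) \<partial>M)"
        by (intro nn_integral_cong) (auto simp: A_def h_def y indicator_def)
      also have "\<dots> = ennreal (norm x powr p) * emeasure M A"
        by (simp add: nn_integral_cmult_indicator)
      also have "\<dots> \<le> (\<integral>\<^sup>+\<omega>\<in>A. ennreal (norm (x + c *\<^sub>R \<xi> \<omega>) powr p) \<partial>M)"
        by (rule conditional_Jensen_on_set[OF p \<open>conditionally_centered M F \<xi>\<close> F \<xi> A])
      also have "\<dots> = (\<integral>\<^sup>+\<omega>\<in>A. ennreal (norm (S \<omega> + g \<omega> *\<^sub>R \<xi> \<omega>) powr p) \<partial>M)"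
        by (intro nn_integral_cong) (auto simp: A_def h_def y indicator_def)
      finally show "(\<integral>\<^sup>+\<omega>\<in>h -` {y} \<inter> space M. ennreal (norm (S \<omega>) powr p) \<partial>M)
        \<le> (\<integral>\<^sup>+\<omega>\<in>h -` {y} \<inter> space M. ennreal (norm (S \<omega> + g \<omega> *\<^sub>R \<xi> \<omega>) powr p) \<partial>M)"
        unfolding A_def .
    qed
  qed
qed

lemma powr_add_le:
  fixes a b p :: real
  assumes "0 < p" "0 \<le> a" "0 \<le> b"
  shows "(a + b) powr p \<le> 2 powr p * (a powr p + b powr p)"
proof -
  have "(a + b) powr p \<le> (2 * max a b) powr p"
    using assms by (intro powr_mono2) auto
  also have "\<dots> = 2 powr p * max (a powr p) (b powr p)"
    using assms powr_mono2[of p a b] powr_mono2[of p b a] by (auto simp: powr_mult max_def)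
  also have "\<dots> \<le> 2 powr p * (a powr p + b powr p)"
    by (intro mult_left_mono) auto
  finally show ?thesis .
qed

text \<open>Simple approximants of \<open>S\<close> and \<open>g\<close> taken from \<open>F\<close>
  reduce this to the previous case; the two moment hypotheses make the common majorant integrable,
  so both sides converge.\<close>

lemma (in prob_space) conditional_Jensen:
  fixes S \<xi> :: "'a \<Rightarrow> 'b::real_normed_vector" and g :: "'a \<Rightarrow> real"
  assumes p: "1 < p" and c: "conditionally_centered M F \<xi>" and F: "subalgebra M F"
    and \<xi>: "strongly_measurable M \<xi>" and S: "strongly_measurable F S"
    and g: "g \<in> borel_measurable F" and g1: "\<And>\<omega>. \<bar>g \<omega>\<bar> \<le> 1"
    and intS: "(\<integral>\<^sup>+\<omega>. ennreal (norm (S \<omega>) powr p) \<partial>M) < \<infinity>"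
    and int\<xi>: "(\<integral>\<^sup>+\<omega>. ennreal (norm (\<xi> \<omega>) powr p) \<partial>M) < \<infinity>"
  shows "(\<integral>\<^sup>+\<omega>. ennreal (norm (S \<omega>) powr p) \<partial>M) \<le> (\<integral>\<^sup>+\<omega>. ennreal (norm (S \<omega> + g \<omega> *\<^sub>R \<xi> \<omega>) powr p) \<partial>M)"
proof -
  have sp: "space F = space M" using F by (simp add: subalgebra_def)
  obtain s where s: "\<And>i. simple_function F (s i)" "\<And>x. x \<in> space F \<Longrightarrow> (\<lambda>i. s i x) \<longlonglongrightarrow> S x"
    "\<And>i x. norm (s i x) \<le> 2 * norm (S x)"
    using strongly_measurable_dominated_approx[OF S] by blast
  obtain t where t: "\<And>i. simple_function F (t i)" "\<And>x. x \<in> space F \<Longrightarrow> (\<lambda>i. t i x) \<longlonglongrightarrow> g x"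
    "\<And>i x. norm (t i x) \<le> 2 * norm (g x)"
    using strongly_measurable_dominated_approx[OF strongly_measurable_real[OF g]] by blast
  have S': "strongly_measurable M S" and g': "g \<in> borel_measurable M"
    using strongly_measurable_subalgebra[OF F] S strongly_measurable_real[OF g]
    by (auto intro: strongly_measurable_borel)
  have sm: "strongly_measurable M (s i)" "t i \<in> borel_measurable M" for i
    using simple_function_subalgebra[OF F s(1)] simple_function_subalgebra[OF F t(1)]
    by (auto simp: strongly_measurable_def intro: borel_measurable_simple_function exI[of _ "\<lambda>_. s i"])
  have [measurable]: "(\<lambda>\<omega>. norm (S \<omega>)) \<in> borel_measurable M" "(\<lambda>\<omega>. norm (\<xi> \<omega>)) \<in> borel_measurable M"
    "(\<lambda>\<omega>. norm (s i \<omega>)) \<in> borel_measurable M"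
    "(\<lambda>\<omega>. norm (s i \<omega> + t i \<omega> *\<^sub>R \<xi> \<omega>)) \<in> borel_measurable M"
    "(\<lambda>\<omega>. norm (S \<omega> + g \<omega> *\<^sub>R \<xi> \<omega>)) \<in> borel_measurable M" for i
    by (intro strongly_measurable_norm strongly_measurable_add strongly_measurable_scaleR sm \<xi> S' g')+
  \<comment> \<open>The inner factors 2 come from the approximation bounds together with
    \<open>\<bar>g \<omega>\<bar> \<le> 1\<close>, the outer \<open>2 powr p\<close> from
    \<open>powr_add_le\<close>.\<close>
  define w where "w \<omega> = 2 powr p * ((2 * norm (S \<omega>)) powr p + (2 * norm (\<xi> \<omega>)) powr p)" for \<omega>
  have [measurable]: "w \<in> borel_measurable M" unfolding w_def by measurable
  have intw: "(\<integral>\<^sup>+\<omega>. ennreal (w \<omega>) \<partial>M) < \<infinity>"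
  proof -
    have "(\<integral>\<^sup>+\<omega>. ennreal (w \<omega>) \<partial>M) = (\<integral>\<^sup>+\<omega>. ennreal (2 powr p * 2 powr p) *
        (ennreal (norm (S \<omega>) powr p) + ennreal (norm (\<xi> \<omega>) powr p)) \<partial>M)"
      by (intro nn_integral_cong)
        (simp add: w_def powr_mult ennreal_plus[symmetric] ennreal_mult[symmetric] algebra_simps del: ennreal_plus)
    also have "\<dots> = ennreal (2 powr p * 2 powr p) * ((\<integral>\<^sup>+\<omega>. ennreal (norm (S \<omega>) powr p) \<partial>M)
        + (\<integral>\<^sup>+\<omega>. ennreal (norm (\<xi> \<omega>) powr p) \<partial>M))"
      by (simp add: nn_integral_cmult nn_integral_add)
    also have "\<dots> < \<infinity>" using intS int\<xi> by (simp add: ennreal_mult_less_top)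
    finally show ?thesis .
  qed
  have lim_powr: "(\<lambda>i. ennreal (norm (x i) powr p)) \<longlonglongrightarrow> ennreal (norm l powr p)"
    if "x \<longlonglongrightarrow> l" for x :: "nat \<Rightarrow> 'b" and l
    using p that by (intro tendsto_ennrealI tendsto_powr' tendsto_norm tendsto_const) auto
  have 1: "(\<lambda>i. \<integral>\<^sup>+\<omega>. ennreal (norm (s i \<omega>) powr p) \<partial>M) \<longlonglongrightarrow> (\<integral>\<^sup>+\<omega>. ennreal (norm (S \<omega>) powr p) \<partial>M)"
  proof (rule nn_integral_dominated_convergence[where w = w])
    show "AE \<omega> in M. ennreal (norm (s i \<omega>) powr p) \<le> ennreal (w \<omega>)" for i
    proof (intro AE_I2 ennreal_leI)
      fix \<omega>
      have "norm (s i \<omega>) powr p \<le> (2 * norm (S \<omega>) + 2 * norm (\<xi> \<omega>)) powr p"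
        using p s(3)[of i \<omega>] by (intro powr_mono2) (auto intro: add_increasing2)
      also have "\<dots> \<le> w \<omega>" unfolding w_def using p by (intro powr_add_le) auto
      finally show "norm (s i \<omega>) powr p \<le> w \<omega>" .
    qed
    show "AE \<omega> in M. (\<lambda>i. ennreal (norm (s i \<omega>) powr p)) \<longlonglongrightarrow> ennreal (norm (S \<omega>) powr p)"
      using s(2) by (intro AE_I2 lim_powr) (simp add: sp)
  qed (use intw in measurable)
  have 2: "(\<lambda>i. \<integral>\<^sup>+\<omega>. ennreal (norm (s i \<omega> + t i \<omega> *\<^sub>R \<xi> \<omega>) powr p) \<partial>M)
      \<longlonglongrightarrow> (\<integral>\<^sup>+\<omega>. ennreal (norm (S \<omega> + g \<omega> *\<^sub>R \<xi> \<omega>) powr p) \<partial>M)"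
  proof (rule nn_integral_dominated_convergence[where w = w])
    show "AE \<omega> in M. ennreal (norm (s i \<omega> + t i \<omega> *\<^sub>R \<xi> \<omega>) powr p) \<le> ennreal (w \<omega>)" for i
    proof (intro AE_I2 ennreal_leI)
      fix \<omega>
      have "norm (t i \<omega> *\<^sub>R \<xi> \<omega>) \<le> 2 * norm (\<xi> \<omega>)"
        using t(3)[of i \<omega>] g1[of \<omega>] by (simp add: mult_right_mono)
      then have "norm (s i \<omega> + t i \<omega> *\<^sub>R \<xi> \<omega>) \<le> 2 * norm (S \<omega>) + 2 * norm (\<xi> \<omega>)"
        using s(3)[of i \<omega>] norm_triangle_ineq[of "s i \<omega>" "t i \<omega> *\<^sub>R \<xi> \<omega>"] by linarith
      then have "norm (s i \<omega> + t i \<omega> *\<^sub>R \<xi> \<omega>) powr p \<le> (2 * norm (S \<omega>) + 2 * norm (\<xi> \<omega>)) powr p"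
        using p by (intro powr_mono2) auto
      also have "\<dots> \<le> w \<omega>" unfolding w_def using p by (intro powr_add_le) auto
      finally show "norm (s i \<omega> + t i \<omega> *\<^sub>R \<xi> \<omega>) powr p \<le> w \<omega>" .
    qed
    show "AE \<omega> in M. (\<lambda>i. ennreal (norm (s i \<omega> + t i \<omega> *\<^sub>R \<xi> \<omega>) powr p))
        \<longlonglongrightarrow> ennreal (norm (S \<omega> + g \<omega> *\<^sub>R \<xi> \<omega>) powr p)"
      using s(2) t(2) by (intro AE_I2 lim_powr tendsto_add tendsto_scaleR tendsto_const) (simp_all add: sp)
  qed (use intw in measurable)
  show ?thesis
    using conditional_Jensen_simple[OF p c F \<xi> s(1) t(1)] by (intro LIMSEQ_le[OF 1 2]) auto
qed

section \<open>Martingale transforms in a uniformly smooth space\<close>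

text \<open>\<open>\<xi> n\<close> is the increment between times n and n + 1: it is revealed by
  \<open>F (Suc n)\<close> and centered given \<open>F n\<close>. Multipliers of
  \<open>\<xi> n\<close> are thus predictable exactly when they are measurable with respect to
  \<open>F n\<close>.\<close>

locale centered_noise = prob_space M
  for M :: "'a measure" +
  fixes F :: "nat \<Rightarrow> 'a measure" and \<xi> :: "nat \<Rightarrow> 'a \<Rightarrow> 'b::banach"
    and p D :: real and \<tau> :: "nat \<Rightarrow> real"
  assumes p: "1 < p" and D: "0 \<le> D"
    and smooth: "\<And>x y :: 'b. norm (x + y) powr p + norm (x - y) powr p \<le> 2 * norm x powr p + D * norm y powr p"
    and subalg: "\<And>n. subalgebra M (F n)" and mono_F: "\<And>n. subalgebra (F (Suc n)) (F n)"
    and adapted: "\<And>n. strongly_measurable (F (Suc n)) (\<xi> n)"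
    and centered: "\<And>n. conditionally_centered M (F n) (\<xi> n)"
    and moment: "\<And>n. (\<integral>\<^sup>+\<omega>. ennreal (norm (\<xi> n \<omega>) powr p) \<partial>M) \<le> ennreal (\<tau> n)"
    and tau: "\<And>n. 0 \<le> \<tau> n" "summable \<tau>"
begin

lemma xi_measurable: "strongly_measurable M (\<xi> n)"
  using strongly_measurable_subalgebra[OF subalg adapted] .

lemma moment_finite: "(\<integral>\<^sup>+\<omega>. ennreal (norm (\<xi> n \<omega>) powr p) \<partial>M) < \<infinity>"
  using le_less_trans[OF moment ennreal_less_top] by simp

lemma subalgebra_filtration: "i \<le> j \<Longrightarrow> subalgebra (F j) (F i)"
proof (induction j rule: dec_induct)
  case base
  then show ?case by (simp add: subalgebra_def)
next
  case (step n)
  then show ?case using mono_F[of n] by (auto simp: subalgebra_def)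
qed

lemma transform_adapted:
  assumes "\<And>k. g k \<in> borel_measurable (F k)" "n \<le> N"
  shows "strongly_measurable (F N) (\<lambda>\<omega>. \<Sum>k=m..<n. g k \<omega> *\<^sub>R \<xi> k \<omega>)"
proof (rule strongly_measurable_sum)
  fix k assume "k \<in> {m..<n}"
  then have k: "subalgebra (F N) (F k)" "subalgebra (F N) (F (Suc k))"
    using assms(2) by (auto intro!: subalgebra_filtration)
  show "strongly_measurable (F N) (\<lambda>\<omega>. g k \<omega> *\<^sub>R \<xi> k \<omega>)"
    by (rule strongly_measurable_scaleR[OF measurable_from_subalg[OF k(1) assms(1)]
        strongly_measurable_subalgebra[OF k(2) adapted]])
qed

lemma transform_measurable:
  assumes "\<And>k. g k \<in> borel_measurable (F k)"
  shows "strongly_measurable M (\<lambda>\<omega>. \<Sum>k=m..<n. g k \<omega> *\<^sub>R \<xi> k \<omega>)"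
  using strongly_measurable_subalgebra[OF subalg transform_adapted[of g n n m]] assms by blast

text \<open>Uniform smoothness with \<open>x = S\<close> and \<open>y = g \<xi>\<close>, the term \<open>norm (x - y) powr p\<close> being bounded
  below by Jensen's inequality.\<close>

lemma transform_moment_step:
  fixes S :: "'a \<Rightarrow> 'b"
  assumes S: "strongly_measurable (F n) S" and g: "g \<in> borel_measurable (F n)" and g1: "\<And>\<omega>. \<bar>g \<omega>\<bar> \<le> 1"
    and intS: "(\<integral>\<^sup>+\<omega>. ennreal (norm (S \<omega>) powr p) \<partial>M) < \<infinity>"
  shows "(\<integral>\<^sup>+\<omega>. ennreal (norm (S \<omega> + g \<omega> *\<^sub>R \<xi> n \<omega>) powr p) \<partial>M)
      \<le> (\<integral>\<^sup>+\<omega>. ennreal (norm (S \<omega>) powr p) \<partial>M) + ennreal (D * \<tau> n)"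
proof -
  have S': "strongly_measurable M S" and g': "g \<in> borel_measurable M"
    using strongly_measurable_subalgebra[OF subalg S] measurable_from_subalg[OF subalg g] by auto
  have [measurable]: "(\<lambda>\<omega>. norm (S \<omega>)) \<in> borel_measurable M" "(\<lambda>\<omega>. norm (\<xi> n \<omega>)) \<in> borel_measurable M"
    "(\<lambda>\<omega>. norm (S \<omega> + g \<omega> *\<^sub>R \<xi> n \<omega>)) \<in> borel_measurable M"
    "(\<lambda>\<omega>. norm (S \<omega> - g \<omega> *\<^sub>R \<xi> n \<omega>)) \<in> borel_measurable M"
    by (intro strongly_measurable_norm strongly_measurable_add strongly_measurable_diff
        strongly_measurable_scaleR xi_measurable S' g')+
  let ?I = "\<integral>\<^sup>+\<omega>. ennreal (norm (S \<omega>) powr p) \<partial>M"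
  let ?J = "\<integral>\<^sup>+\<omega>. ennreal (norm (S \<omega> + g \<omega> *\<^sub>R \<xi> n \<omega>) powr p) \<partial>M"
  have "(\<integral>\<^sup>+\<omega>. ennreal (norm (S \<omega>) powr p) \<partial>M)
      \<le> (\<integral>\<^sup>+\<omega>. ennreal (norm (S \<omega> + (- g \<omega>) *\<^sub>R \<xi> n \<omega>) powr p) \<partial>M)"
    using g g1 by (intro conditional_Jensen[OF p centered subalg xi_measurable S _ _ intS moment_finite]) auto
  then have J: "?I \<le> (\<integral>\<^sup>+\<omega>. ennreal (norm (S \<omega> - g \<omega> *\<^sub>R \<xi> n \<omega>) powr p) \<partial>M)" by simp
  \<comment> \<open>Smoothness bounds this sum by \<open>2 * ?I\<close> plus the new moment.
    Cancelling \<open>?I\<close>, which is finite by \<open>intS\<close>, leaves coefficient 1 in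
    front of the old moment.\<close>
  have "?J + ?I \<le> ?J + (\<integral>\<^sup>+\<omega>. ennreal (norm (S \<omega> - g \<omega> *\<^sub>R \<xi> n \<omega>) powr p) \<partial>M)"
    using J by (rule add_left_mono)
  also have "\<dots> = (\<integral>\<^sup>+\<omega>. ennreal (norm (S \<omega> + g \<omega> *\<^sub>R \<xi> n \<omega>) powr p + norm (S \<omega> - g \<omega> *\<^sub>R \<xi> n \<omega>) powr p) \<partial>M)"
    by (simp add: nn_integral_add[symmetric])
  also have "\<dots> \<le> (\<integral>\<^sup>+\<omega>. ennreal (2 * norm (S \<omega>) powr p + D * norm (\<xi> n \<omega>) powr p) \<partial>M)"
  proof (intro nn_integral_mono ennreal_leI)
    fix \<omega>
    have "norm (g \<omega> *\<^sub>R \<xi> n \<omega>) powr p \<le> norm (\<xi> n \<omega>) powr p"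
      using p g1[of \<omega>] by (intro powr_mono2) (auto intro: mult_left_le_one_le)
    then have "D * norm (g \<omega> *\<^sub>R \<xi> n \<omega>) powr p \<le> D * norm (\<xi> n \<omega>) powr p"
      using D by (rule mult_left_mono)
    then show "norm (S \<omega> + g \<omega> *\<^sub>R \<xi> n \<omega>) powr p + norm (S \<omega> - g \<omega> *\<^sub>R \<xi> n \<omega>) powr p
        \<le> 2 * norm (S \<omega>) powr p + D * norm (\<xi> n \<omega>) powr p"
      using smooth[of "S \<omega>" "g \<omega> *\<^sub>R \<xi> n \<omega>"] by linarith
  qed
  also have "\<dots> = 2 * ?I + ennreal D * (\<integral>\<^sup>+\<omega>. ennreal (norm (\<xi> n \<omega>) powr p) \<partial>M)"
    using D by (simp add: nn_integral_add nn_integral_cmult ennreal_mult)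
  also have "\<dots> \<le> 2 * ?I + ennreal D * ennreal (\<tau> n)"
    by (intro add_left_mono mult_left_mono moment) simp
  finally have "?I + ?J \<le> ?I + (?I + ennreal (D * \<tau> n))"
    using D tau(1) by (simp add: ennreal_mult mult_2 ac_simps)
  then show ?thesis using intS by (auto simp: ennreal_add_left_cancel_le)
qed

text \<open>Because each step has coefficient 1 on the previous moment, the errors add up instead of
  being multiplied by a growing constant.\<close>

lemma transform_moment:
  assumes g: "\<And>k. g k \<in> borel_measurable (F k)" and g1: "\<And>k \<omega>. \<bar>g k \<omega>\<bar> \<le> 1" and "m \<le> n"
  shows "(\<integral>\<^sup>+\<omega>. ennreal (norm (\<Sum>k=m..<n. g k \<omega> *\<^sub>R \<xi> k \<omega>) powr p) \<partial>M) \<le> ennreal (D * (\<Sum>k=m..<n. \<tau> k))"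
  using \<open>m \<le> n\<close>
proof (induction n rule: dec_induct)
  case base
  then show ?case using p by simp
next
  case (step n)
  let ?S = "\<lambda>\<omega>. \<Sum>k=m..<n. g k \<omega> *\<^sub>R \<xi> k \<omega>"
  have "(\<integral>\<^sup>+\<omega>. ennreal (norm (\<Sum>k=m..<Suc n. g k \<omega> *\<^sub>R \<xi> k \<omega>) powr p) \<partial>M)
      = (\<integral>\<^sup>+\<omega>. ennreal (norm (?S \<omega> + g n \<omega> *\<^sub>R \<xi> n \<omega>) powr p) \<partial>M)"
    using step.hyps by simp
  also have "\<dots> \<le> (\<integral>\<^sup>+\<omega>. ennreal (norm (?S \<omega>) powr p) \<partial>M) + ennreal (D * \<tau> n)"
    using le_less_trans[OF step.IH ennreal_less_top]
    by (intro transform_moment_step transform_adapted g g1) auto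
  also have "\<dots> \<le> ennreal (D * (\<Sum>k=m..<n. \<tau> k)) + ennreal (D * \<tau> n)"
    using step.IH by (rule add_right_mono)
  also have "\<dots> = ennreal (D * (\<Sum>k=m..<Suc n. \<tau> k))"
    using D tau step.hyps by (simp add: ennreal_plus[symmetric] sum_nonneg distrib_left del: ennreal_plus)
  finally show ?case .
qed

text \<open>Doob's argument: switching the multipliers off once the transform has reached \<open>\<epsilon>\<close>
  keeps the final value at least \<open>\<epsilon>\<close>.\<close>

lemma transform_maximal:
  assumes g: "\<And>k. g k \<in> borel_measurable (F k)" and g1: "\<And>k \<omega>. \<bar>g k \<omega>\<bar> \<le> 1"
    and eps: "0 < \<epsilon>" and mn: "m \<le> n"
  shows "ennreal (\<epsilon> powr p) * emeasure M {\<omega>\<in>space M. \<exists>j\<in>{m..n}. \<epsilon> \<le> norm (\<Sum>k=m..<j. g k \<omega> *\<^sub>R \<xi> k \<omega>)}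
      \<le> ennreal (D * (\<Sum>k=m..<n. \<tau> k))"
proof -
  define U where "U j \<omega> = (\<Sum>k=m..<j. g k \<omega> *\<^sub>R \<xi> k \<omega>)" for j \<omega>
  \<comment> \<open>The switch at time k looks only at \<open>U j\<close> with j \<le> k, whose last
    increment is \<open>\<xi> (j - 1)\<close>; hence the new multipliers are still
    predictable.\<close>
  define g' where "g' k \<omega> = (if \<forall>j\<in>{m..k}. norm (U j \<omega>) < \<epsilon> then g k \<omega> else 0)" for k \<omega>
  define V where "V j \<omega> = (\<Sum>k=m..<j. g' k \<omega> *\<^sub>R \<xi> k \<omega>)" for j \<omega>
  have U_meas: "(\<lambda>\<omega>. norm (U j \<omega>)) \<in> borel_measurable (F k)" if "j \<le> k" for j k
    unfolding U_def using that by (intro strongly_measurable_norm transform_adapted g)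
  have g': "g' k \<in> borel_measurable (F k)" for k
    unfolding g'_def
  proof (intro measurable_If g measurable_const)
    have "{\<omega>\<in>space (F k). norm (U j \<omega>) < \<epsilon>} \<in> sets (F k)" if "j \<in> {m..k}" for j
      using U_meas[of j k] that by (intro borel_measurable_less) auto
    then show "{\<omega>\<in>space (F k). \<forall>j\<in>{m..k}. norm (U j \<omega>) < \<epsilon>} \<in> sets (F k)"
      by (rule sets.sets_Collect_finite_All) simp_all
  qed auto
  have g'1: "\<bar>g' k \<omega>\<bar> \<le> 1" for k \<omega> using g1 by (simp add: g'_def)
  have [measurable]: "(\<lambda>\<omega>. norm (U j \<omega>)) \<in> borel_measurable M" "(\<lambda>\<omega>. norm (V j \<omega>)) \<in> borel_measurable M" for j
    unfolding U_def V_def by (intro strongly_measurable_norm transform_measurable g g')+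
  \<comment> \<open>Both branches are carried through the induction: before the crossing
    \<open>V\<close> copies \<open>U\<close>, so it inherits the value at the crossing time, and
    afterwards it is frozen.\<close>
  have stop: "if \<forall>j\<in>{m..n}. norm (U j \<omega>) < \<epsilon> then V n \<omega> = U n \<omega> else \<epsilon> \<le> norm (V n \<omega>)" for \<omega>
    using mn
  proof (induction n rule: dec_induct)
    case base
    then show ?case using eps by (simp add: U_def V_def)
  next
    case (step n)
    have Suc: "U (Suc n) \<omega> = U n \<omega> + g n \<omega> *\<^sub>R \<xi> n \<omega>" "V (Suc n) \<omega> = V n \<omega> + g' n \<omega> *\<^sub>R \<xi> n \<omega>"
      using step.hyps by (auto simp: U_def V_def)
    have ins: "{m..Suc n} = insert (Suc n) {m..n}" using step.hyps by auto
    show ?case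
    proof (cases "\<forall>j\<in>{m..n}. norm (U j \<omega>) < \<epsilon>")
      case True
      then have "V (Suc n) \<omega> = U (Suc n) \<omega>" using step.IH by (simp add: Suc g'_def)
      then show ?thesis using True by (simp add: ins not_less)
    next
      case False
      then have "g' n \<omega> = 0" unfolding g'_def by (simp only: if_False)
      then have "V (Suc n) \<omega> = V n \<omega>" by (simp add: Suc)
      moreover have "\<not> (\<forall>j\<in>{m..Suc n}. norm (U j \<omega>) < \<epsilon>)" using False unfolding ins by blast
      ultimately show ?thesis using False step.IH by (simp only: if_False)
    qed
  qed
  define A where "A = {\<omega>\<in>space M. \<exists>j\<in>{m..n}. \<epsilon> \<le> norm (U j \<omega>)}"
  have [measurable]: "A \<in> sets M" unfolding A_def by measurable
  have "ennreal (\<epsilon> powr p) * emeasure M A = (\<integral>\<^sup>+\<omega>. ennreal (\<epsilon> powr p) * indicator A \<omega> \<partial>M)"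
    by (simp add: nn_integral_cmult_indicator)
  also have "\<dots> \<le> (\<integral>\<^sup>+\<omega>. ennreal (norm (V n \<omega>) powr p) \<partial>M)"
  proof (rule nn_integral_mono)
    fix \<omega>
    show "ennreal (\<epsilon> powr p) * indicator A \<omega> \<le> ennreal (norm (V n \<omega>) powr p)"
    proof (cases "\<omega> \<in> A")
      case True
      then have "\<epsilon> \<le> norm (V n \<omega>)" using stop[of \<omega>] by (force simp: A_def split: if_splits)
      then show ?thesis using eps p True by (auto intro!: ennreal_leI powr_mono2)
    qed simp
  qed
  also have "\<dots> \<le> ennreal (D * (\<Sum>k=m..<n. \<tau> k))"
    unfolding V_def by (rule transform_moment[OF g' g'1 mn])
  finally show ?thesis unfolding A_def U_def .
qed

text \<open>The events increase with the horizon and the finite-horizon bounds stay below the tail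
  sum of \<open>\<tau>\<close>, so continuity from below applies.\<close>

lemma transform_maximal_infinite:
  assumes g: "\<And>k. g k \<in> borel_measurable (F k)" and g1: "\<And>k \<omega>. \<bar>g k \<omega>\<bar> \<le> 1" and eps: "0 < \<epsilon>"
  shows "{\<omega>\<in>space M. \<exists>j\<ge>m. \<epsilon> \<le> norm (\<Sum>k=m..<j. g k \<omega> *\<^sub>R \<xi> k \<omega>)} \<in> sets M" (is "?A \<in> sets M")
    and "ennreal (\<epsilon> powr p) * emeasure M {\<omega>\<in>space M. \<exists>j\<ge>m. \<epsilon> \<le> norm (\<Sum>k=m..<j. g k \<omega> *\<^sub>R \<xi> k \<omega>)}
      \<le> ennreal (D * (\<Sum>k. \<tau> (k + m)))"
proof -
  have [measurable]: "(\<lambda>\<omega>. norm (\<Sum>k=m..<j. g k \<omega> *\<^sub>R \<xi> k \<omega>)) \<in> borel_measurable M" for j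
    by (intro strongly_measurable_norm transform_measurable g)
  show "?A \<in> sets M" by measurable
  define A where "A n = {\<omega>\<in>space M. \<exists>j\<in>{m..m+n}. \<epsilon> \<le> norm (\<Sum>k=m..<j. g k \<omega> *\<^sub>R \<xi> k \<omega>)}" for n
  have A: "A n \<in> sets M" for n unfolding A_def by measurable
  have "(SUP n. emeasure M (A n)) = emeasure M (\<Union>n. A n)"
  proof (rule SUP_emeasure_incseq)
    show "incseq A" unfolding A_def incseq_def by fastforce
  qed (use A in auto)
  moreover have "(\<Union>n. A n) = ?A"
  proof -
    have "\<exists>n. j \<in> {m..m+n}" if "m \<le> j" for j using that by (intro exI[of _ "j - m"]) auto
    then show ?thesis unfolding A_def by fastforce
  qed
  ultimately have "ennreal (\<epsilon> powr p) * emeasure M ?A = ennreal (\<epsilon> powr p) * (SUP n. emeasure M (A n))"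
    by simp
  also have "\<dots> = (SUP n. ennreal (\<epsilon> powr p) * emeasure M (A n))"
    by (rule SUP_mult_left_ennreal)
  also have "\<dots> \<le> ennreal (D * (\<Sum>k. \<tau> (k + m)))"
  proof (rule SUP_least)
    fix n
    have "ennreal (\<epsilon> powr p) * emeasure M (A n) \<le> ennreal (D * (\<Sum>k=m..<m+n. \<tau> k))"
      unfolding A_def by (rule transform_maximal[OF g g1 eps]) simp
    also have "(\<Sum>k=m..<m+n. \<tau> k) = (\<Sum>k<n. \<tau> (k + m))"
      using sum.shift_bounds_nat_ivl[of \<tau> 0 m n] by (simp add: add.commute atLeast0LessThan)
    also have "ennreal (D * (\<Sum>k<n. \<tau> (k + m))) \<le> ennreal (D * (\<Sum>k. \<tau> (k + m)))"
      using tau D by (intro ennreal_leI mult_left_mono sum_le_suminf) (auto simp: summable_iff_shift)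
    finally show "ennreal (\<epsilon> powr p) * emeasure M (A n) \<le> ennreal (D * (\<Sum>k. \<tau> (k + m)))" .
  qed
  finally show "ennreal (\<epsilon> powr p) * emeasure M ?A \<le> ennreal (D * (\<Sum>k. \<tau> (k + m)))" .
qed

text \<open>A path without such an \<open>m\<close> lies in every bad set \<open>A m\<close>, and
  the measures of these are bounded by a constant times tails of \<open>\<tau>\<close>. One
  \<open>m\<close> for each \<epsilon> is all that the Cauchy criterion asks for, since two late
  partial sums are both compared with the one at \<open>m\<close>.\<close>

lemma transform_AE_small_oscillation:
  assumes g: "\<And>k. g k \<in> borel_measurable (F k)" and g1: "\<And>k \<omega>. \<bar>g k \<omega>\<bar> \<le> 1" and eps: "0 < \<epsilon>"
  shows "AE \<omega> in M. \<exists>m. \<forall>j\<ge>m. norm (\<Sum>k=m..<j. g k \<omega> *\<^sub>R \<xi> k \<omega>) < \<epsilon>"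
proof -
  define A where "A m = {\<omega>\<in>space M. \<exists>j\<ge>m. \<epsilon> \<le> norm (\<Sum>k=m..<j. g k \<omega> *\<^sub>R \<xi> k \<omega>)}" for m
  note A = transform_maximal_infinite[of g, OF g g1 eps, folded A_def]
  have lim: "(\<lambda>m. ennreal (D * (\<Sum>k. \<tau> (k + m)))) \<longlonglongrightarrow> ennreal (D * 0)"
    by (intro tendsto_ennrealI tendsto_mult tendsto_const suminf_exist_split2 tau)
  have le: "ennreal (\<epsilon> powr p) * emeasure M (\<Inter>m. A m) \<le> ennreal (D * (\<Sum>k. \<tau> (k + m)))" for m
    by (rule order_trans[OF mult_left_mono[OF emeasure_mono] A(2)]) (auto intro: A(1))
  have "ennreal (\<epsilon> powr p) * emeasure M (\<Inter>m. A m) \<le> ennreal (D * 0)"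
    by (rule LIMSEQ_le_const[OF lim]) (use le in blast)
  then have "emeasure M (\<Inter>m. A m) = 0" using eps by simp
  then have "(\<Inter>m. A m) \<in> null_sets M" using A(1) by (auto simp: null_sets_def)
  then show ?thesis by (rule AE_I') (auto simp: A_def not_less not_le)
qed

theorem transform_AE_summable:
  assumes g: "\<And>k. g k \<in> borel_measurable (F k)" and g1: "\<And>k \<omega>. \<bar>g k \<omega>\<bar> \<le> 1"
  shows "AE \<omega> in M. summable (\<lambda>k. g k \<omega> *\<^sub>R \<xi> k \<omega>)"
proof -
  have "AE \<omega> in M. \<forall>i. \<exists>m. \<forall>j\<ge>m. norm (\<Sum>k=m..<j. g k \<omega> *\<^sub>R \<xi> k \<omega>) < 1 / Suc i"
    unfolding AE_all_countable by (intro allI transform_AE_small_oscillation[of g, OF g g1]) simp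
  then show ?thesis
  proof (rule AE_mp, intro AE_I2 impI)
    fix \<omega> assume osc: "\<forall>i. \<exists>m. \<forall>j\<ge>m. norm (\<Sum>k=m..<j. g k \<omega> *\<^sub>R \<xi> k \<omega>) < 1 / Suc i"
    define f where "f k = g k \<omega> *\<^sub>R \<xi> k \<omega>" for k
    have "Cauchy (\<lambda>n. \<Sum>k<n. f k)"
    proof (rule CauchyI)
      fix e :: real assume "0 < e"
      then obtain i where i: "1 / Suc i < e / 2"
        using reals_Archimedean[of "e / 2"] by (auto simp: inverse_eq_divide)
      from osc have "\<exists>m. \<forall>j\<ge>m. norm (\<Sum>k=m..<j. f k) < 1 / Suc i" unfolding f_def ..
      then obtain m where "\<forall>j\<ge>m. norm (\<Sum>k=m..<j. f k) < 1 / Suc i" ..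
      then have m: "norm (\<Sum>k=m..<j. f k) < 1 / Suc i" if "m \<le> j" for j
        using that by simp
      have split: "(\<Sum>k<j. f k) = (\<Sum>k<m. f k) + (\<Sum>k=m..<j. f k)" if "m \<le> j" for j
        using sum.atLeastLessThan_concat[of 0 m j f] that by (simp add: atLeast0LessThan)
      show "\<exists>M. \<forall>a\<ge>M. \<forall>b\<ge>M. norm ((\<Sum>k<a. f k) - (\<Sum>k<b. f k)) < e"
      proof (rule exI[of _ m], intro allI impI)
        fix a b assume ab: "m \<le> a" "m \<le> b"
        have "norm ((\<Sum>k<a. f k) - (\<Sum>k<b. f k)) = norm ((\<Sum>k=m..<a. f k) - (\<Sum>k=m..<b. f k))"
          by (simp add: split[OF ab(1)] split[OF ab(2)])
        also have "\<dots> \<le> norm (\<Sum>k=m..<a. f k) + norm (\<Sum>k=m..<b. f k)" by (rule norm_triangle_ineq4)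
        also have "\<dots> < e" using m[OF ab(1)] m[OF ab(2)] i by linarith
        finally show "norm ((\<Sum>k<a. f k) - (\<Sum>k<b. f k)) < e" .
      qed
    qed
    then show "summable (\<lambda>k. g k \<omega> *\<^sub>R \<xi> k \<omega>)"
      unfolding f_def summable_iff_convergent by (rule Cauchy_convergent)
  qed
qed

end

section \<open>From Bochner conditional expectations to centered noise\<close>

lemma (in prob_space) simple_bochner_integrable_finite:
  "simple_function M f \<Longrightarrow> Bochner_Integration.simple_bochner_integrable M f"
  by (auto intro!: simple_bochner_integrable.intros)

lemma norm_simple_bochner_integral_le:
  fixes f :: "'a \<Rightarrow> 'b::real_normed_vector"
  assumes f: "Bochner_Integration.simple_bochner_integrable M f"
  shows "ennreal (norm (Bochner_Integration.simple_bochner_integral M f)) \<le> (\<integral>\<^sup>+x. ennreal (norm (f x)) \<partial>M)"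
proof -
  have "Bochner_Integration.simple_bochner_integrable M (\<lambda>x. norm (f x))"
    using simple_bochner_integrable_compose2[where p = "\<lambda>x y. norm x", OF _ f f] by simp
  from simple_bochner_integral_eq_nn_integral[OF this]
  show ?thesis
    using ennreal_leI[OF simple_bochner_integral_norm_bound[OF f]] by simp
qed

lemma (in prob_space) norm_simple_bochner_integral_indicator:
  fixes x :: "'b::real_normed_vector"
  assumes [measurable]: "A \<in> sets M"
  shows "ennreal (norm (Bochner_Integration.simple_bochner_integral M (\<lambda>\<omega>. indicator A \<omega> *\<^sub>R x)))
    = ennreal (norm x) * emeasure M A"
proof -
  have sb: "Bochner_Integration.simple_bochner_integrable M (indicator A :: _ \<Rightarrow> real)"
    by (intro simple_bochner_integrable_finite) simp
  have "Bochner_Integration.simple_bochner_integral M (\<lambda>\<omega>. indicator A \<omega> *\<^sub>R x)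
      = Bochner_Integration.simple_bochner_integral M (indicator A) *\<^sub>R x"
    using simple_bochner_integral_linear[OF linear_scaleR_left sb] .
  moreover have "ennreal (Bochner_Integration.simple_bochner_integral M (indicator A)) = emeasure M A"
    by (subst simple_bochner_integral_eq_nn_integral[OF sb]) (auto simp: ennreal_indicator)
  moreover have "0 \<le> Bochner_Integration.simple_bochner_integral M (indicator A :: _ \<Rightarrow> real)"
    by (rule simple_bochner_integral_nonneg) simp
  ultimately show ?thesis by (simp add: ennreal_mult mult.commute)
qed

text \<open>Simple approximants \<open>s i\<close> and \<open>t i\<close> of X and W restricted to
  \<open>A\<close> have integrals with the same limit \<open>I\<close>, so their difference
  contributes nothing in the limit. All vector integrals in the argument are of simple functions;
  the rest is estimates of norms, where the modifications can replace X and W.\<close>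

lemma (in prob_space) conditionally_centered_cond_exp:
  fixes X W X' W' :: "'a \<Rightarrow> 'b::real_normed_vector"
  assumes ce: "is_cond_exp M F X W"
    and X': "strongly_measurable M X'" "AE \<omega> in M. X' \<omega> = X \<omega>"
    and W': "strongly_measurable M W'" "AE \<omega> in M. W' \<omega> = W \<omega>"
  shows "conditionally_centered M F (\<lambda>\<omega>. X' \<omega> - W' \<omega>)"
  unfolding conditionally_centered_def
proof (intro ballI allI)
  fix A and x :: 'b assume A: "A \<in> sets F"
  have F: "subalgebra M F" using ce by (simp add: is_cond_exp_def)
  have A_M [measurable]: "A \<in> sets M" using A F by (auto simp: subalgebra_def)
  obtain I where I: "has_bochner_int M (\<lambda>\<omega>. indicator A \<omega> *\<^sub>R X \<omega>) I"
    "has_bochner_int M (\<lambda>\<omega>. indicator A \<omega> *\<^sub>R W \<omega>) I"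
    using ce A unfolding is_cond_exp_def by blast
  obtain s where s: "\<And>i. Bochner_Integration.simple_bochner_integrable M (s i)"
    "(\<lambda>i. \<integral>\<^sup>+\<omega>. norm (indicator A \<omega> *\<^sub>R X \<omega> - s i \<omega>) \<partial>M) \<longlonglongrightarrow> 0"
    "(\<lambda>i. Bochner_Integration.simple_bochner_integral M (s i)) \<longlonglongrightarrow> I"
    using I(1) unfolding has_bochner_int_def by blast
  obtain t where t: "\<And>i. Bochner_Integration.simple_bochner_integrable M (t i)"
    "(\<lambda>i. \<integral>\<^sup>+\<omega>. norm (indicator A \<omega> *\<^sub>R W \<omega> - t i \<omega>) \<partial>M) \<longlonglongrightarrow> 0"
    "(\<lambda>i. Bochner_Integration.simple_bochner_integral M (t i)) \<longlonglongrightarrow> I"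
    using I(2) unfolding has_bochner_int_def by blast
  let ?S = "\<lambda>f. Bochner_Integration.simple_bochner_integral M f"
  \<comment> \<open>The constant \<open>x\<close> on \<open>A\<close> as a simple function: the norm
    of its integral is the left-hand side of the claim.\<close>
  define a where "a \<omega> = indicator A \<omega> *\<^sub>R x" for \<omega>
  have a: "Bochner_Integration.simple_bochner_integrable M a"
    unfolding a_def by (intro simple_bochner_integrable_finite simple_function_compose1[where g = "\<lambda>r. r *\<^sub>R x"]) simp
  have sm: "strongly_measurable M (s i)" "strongly_measurable M (t i)" for i
    using s(1)[of i] t(1)[of i] unfolding strongly_measurable_def
    by (auto elim!: simple_bochner_integrable.cases intro: exI[of _ "\<lambda>_. s i"] exI[of _ "\<lambda>_. t i"])
  have [measurable]: "(\<lambda>\<omega>. norm (x + (X' \<omega> - W' \<omega>))) \<in> borel_measurable M"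
    "(\<lambda>\<omega>. norm (indicator A \<omega> *\<^sub>R X' \<omega> - s i \<omega>)) \<in> borel_measurable M"
    "(\<lambda>\<omega>. norm (indicator A \<omega> *\<^sub>R W' \<omega> - t i \<omega>)) \<in> borel_measurable M" for i
    by (intro strongly_measurable_norm strongly_measurable_add strongly_measurable_diff
        strongly_measurable_scaleR strongly_measurable_const borel_measurable_indicator A_M X' W' sm)+
  define R where "R = (\<integral>\<^sup>+\<omega>\<in>A. ennreal (norm (x + (X' \<omega> - W' \<omega>))) \<partial>M)"
  define r where "r i = (\<integral>\<^sup>+\<omega>. norm (indicator A \<omega> *\<^sub>R X \<omega> - s i \<omega>) \<partial>M)" for i
  define q where "q i = (\<integral>\<^sup>+\<omega>. norm (indicator A \<omega> *\<^sub>R W \<omega> - t i \<omega>) \<partial>M)" for i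
  have le: "ennreal (norm x) * emeasure M A \<le> R + (r i + q i) + ennreal (norm (?S (s i) - ?S (t i)))" for i
  proof -
    have st: "Bochner_Integration.simple_bochner_integrable M (\<lambda>\<omega>. s i \<omega> - t i \<omega>)"
      "Bochner_Integration.simple_bochner_integrable M (\<lambda>\<omega>. a \<omega> + (s i \<omega> - t i \<omega>))"
      using a s(1)[of i] t(1)[of i]
        simple_bochner_integrable_compose2[where p = "\<lambda>x y. x - y", of M "s i" "t i"]
        simple_bochner_integrable_compose2[where p = "\<lambda>x y. x + y", of M a "\<lambda>\<omega>. s i \<omega> - t i \<omega>"]
      by simp_all
    have "?S (\<lambda>\<omega>. a \<omega> + (s i \<omega> - t i \<omega>)) = ?S a + (?S (s i) - ?S (t i))"
      by (simp add: simple_bochner_integral_add[OF a st(1)] simple_bochner_integral_diff[OF s(1) t(1)])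
    then have "norm (?S a) \<le> norm (?S (\<lambda>\<omega>. a \<omega> + (s i \<omega> - t i \<omega>))) + norm (?S (s i) - ?S (t i))"
      using norm_triangle_ineq4[of "?S (\<lambda>\<omega>. a \<omega> + (s i \<omega> - t i \<omega>))" "?S (s i) - ?S (t i)"] by simp
    then have "ennreal (norm (?S a)) \<le> ennreal (norm (?S (\<lambda>\<omega>. a \<omega> + (s i \<omega> - t i \<omega>))))
        + ennreal (norm (?S (s i) - ?S (t i)))"
      by (simp add: ennreal_plus[symmetric] ennreal_leI del: ennreal_plus)
    also have "ennreal (norm (?S a)) = ennreal (norm x) * emeasure M A"
      unfolding a_def by (rule norm_simple_bochner_integral_indicator) (rule A_M)
    also have "ennreal (norm (?S (\<lambda>\<omega>. a \<omega> + (s i \<omega> - t i \<omega>))))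
        \<le> (\<integral>\<^sup>+\<omega>. ennreal (norm (a \<omega> + (s i \<omega> - t i \<omega>))) \<partial>M)"
      by (rule norm_simple_bochner_integral_le[OF st(2)])
    also have "\<dots> \<le> (\<integral>\<^sup>+\<omega>. ennreal (norm (x + (X' \<omega> - W' \<omega>))) * indicator A \<omega>
        + (ennreal (norm (indicator A \<omega> *\<^sub>R X' \<omega> - s i \<omega>)) + ennreal (norm (indicator A \<omega> *\<^sub>R W' \<omega> - t i \<omega>))) \<partial>M)"
    proof (rule nn_integral_mono)
      fix \<omega>
      have "a \<omega> + (s i \<omega> - t i \<omega>) = indicator A \<omega> *\<^sub>R (x + (X' \<omega> - W' \<omega>))
          + ((indicator A \<omega> *\<^sub>R W' \<omega> - t i \<omega>) - (indicator A \<omega> *\<^sub>R X' \<omega> - s i \<omega>))"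
        by (simp add: a_def algebra_simps)
      also have "norm \<dots> \<le> norm (indicator A \<omega> *\<^sub>R (x + (X' \<omega> - W' \<omega>)))
          + (norm (indicator A \<omega> *\<^sub>R W' \<omega> - t i \<omega>) + norm (indicator A \<omega> *\<^sub>R X' \<omega> - s i \<omega>))"
        by (rule order_trans[OF norm_triangle_ineq add_left_mono[OF norm_triangle_ineq4]])
      finally have "ennreal (norm (a \<omega> + (s i \<omega> - t i \<omega>))) \<le> ennreal (norm (indicator A \<omega> *\<^sub>R (x + (X' \<omega> - W' \<omega>)))
          + (norm (indicator A \<omega> *\<^sub>R X' \<omega> - s i \<omega>) + norm (indicator A \<omega> *\<^sub>R W' \<omega> - t i \<omega>)))"
        by (intro ennreal_leI) simp
      then show "ennreal (norm (a \<omega> + (s i \<omega> - t i \<omega>))) \<le> ennreal (norm (x + (X' \<omega> - W' \<omega>))) * indicator A \<omega>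
        + (ennreal (norm (indicator A \<omega> *\<^sub>R X' \<omega> - s i \<omega>)) + ennreal (norm (indicator A \<omega> *\<^sub>R W' \<omega> - t i \<omega>)))"
        by (cases "\<omega> \<in> A") simp_all
    qed
    also have "\<dots> = R + ((\<integral>\<^sup>+\<omega>. ennreal (norm (indicator A \<omega> *\<^sub>R X' \<omega> - s i \<omega>)) \<partial>M)
        + (\<integral>\<^sup>+\<omega>. ennreal (norm (indicator A \<omega> *\<^sub>R W' \<omega> - t i \<omega>)) \<partial>M))"
      unfolding R_def by (simp add: nn_integral_add)
    also have "(\<integral>\<^sup>+\<omega>. ennreal (norm (indicator A \<omega> *\<^sub>R X' \<omega> - s i \<omega>)) \<partial>M) = r i"
      unfolding r_def by (rule nn_integral_cong_AE, rule AE_mp[OF X'(2)], rule AE_I2) simp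
    also have "(\<integral>\<^sup>+\<omega>. ennreal (norm (indicator A \<omega> *\<^sub>R W' \<omega> - t i \<omega>)) \<partial>M) = q i"
      unfolding q_def by (rule nn_integral_cong_AE, rule AE_mp[OF W'(2)], rule AE_I2) simp
    finally show ?thesis by simp
  qed
  have "(\<lambda>i. ?S (s i) - ?S (t i)) \<longlonglongrightarrow> 0" using tendsto_diff[OF s(3) t(3)] by simp
  then have "(\<lambda>i. norm (?S (s i) - ?S (t i))) \<longlonglongrightarrow> 0" by (rule tendsto_norm_zero)
  then have "(\<lambda>i. ennreal (norm (?S (s i) - ?S (t i)))) \<longlonglongrightarrow> ennreal 0" by (rule tendsto_ennrealI)
  with s(2) t(2) have "(\<lambda>i. R + (r i + q i) + ennreal (norm (?S (s i) - ?S (t i)))) \<longlonglongrightarrow> R + (0 + 0) + ennreal 0"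
    unfolding r_def q_def by (intro tendsto_add tendsto_const)
  then have "ennreal (norm x) * emeasure M A \<le> R + (0 + 0) + ennreal 0"
    by (rule LIMSEQ_le_const) (use le in blast)
  then show "ennreal (norm x) * emeasure M A \<le> (\<integral>\<^sup>+\<omega>\<in>A. ennreal (norm (x + (X' \<omega> - W' \<omega>))) \<partial>M)"
    by (simp add: R_def)
qed

text \<open>The choice \<open>A = space M\<close> in \<open>is_cond_exp\<close> makes both functions
  Bochner integrable, hence almost surely separably valued. Each is modified inside its own
  sigma-algebra.\<close>

lemma cond_exp_modifications:
  fixes X W :: "'a \<Rightarrow> 'b::real_normed_vector"
  assumes ce: "is_cond_exp M F X W" and H: "subalgebra M H" and X: "X \<in> borel_measurable H"
  obtains X' W' where "strongly_measurable H X'" "AE \<omega> in M. X' \<omega> = X \<omega>"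
    "strongly_measurable F W'" "AE \<omega> in M. W' \<omega> = W \<omega>"
proof -
  have F: "subalgebra M F" and W: "W \<in> borel_measurable F" using ce by (auto simp: is_cond_exp_def)
  then have "space M \<in> sets F" using sets.top[of F] by (simp add: subalgebra_def)
  then obtain I where I: "has_bochner_int M (\<lambda>\<omega>. indicator (space M) \<omega> *\<^sub>R X \<omega>) I"
    "has_bochner_int M (\<lambda>\<omega>. indicator (space M) \<omega> *\<^sub>R W \<omega>) I"
    using ce unfolding is_cond_exp_def by blast
  have "(\<lambda>\<omega>. indicator (space M) \<omega> *\<^sub>R X \<omega>) \<in> borel_measurable H"
    by (subst measurable_cong[where g = X]) (use H X in \<open>auto simp: subalgebra_def\<close>)
  then obtain X' where X': "strongly_measurable H X'" "AE \<omega> in M. X' \<omega> = indicator (space M) \<omega> *\<^sub>R X \<omega>"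
    using strongly_measurable_modification[OF H _ I(1)] by blast
  have "(\<lambda>\<omega>. indicator (space M) \<omega> *\<^sub>R W \<omega>) \<in> borel_measurable F"
    by (subst measurable_cong[where g = W]) (use F W in \<open>auto simp: subalgebra_def\<close>)
  then obtain W' where W': "strongly_measurable F W'" "AE \<omega> in M. W' \<omega> = indicator (space M) \<omega> *\<^sub>R W \<omega>"
    using strongly_measurable_modification[OF F _ I(2)] by blast
  have "AE \<omega> in M. X' \<omega> = X \<omega>" "AE \<omega> in M. W' \<omega> = W \<omega>"
    using X'(2) W'(2) AE_space by (eventually_elim; simp)+
  with X' W' show thesis by (intro that)
qed

section \<open>Moment bounds, almost sure summability and the filtration of the noise\<close>

text \<open>A cheap form of Lyapunov's inequality from a pointwise bound: below the level
  \<open>s\<close> the power is at most \<open>s powr p\<close>, above it at most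
  \<open>s powr (p - 2)\<close> times the square, as p \<le> 2. Each part contributes
  \<open>s powr p\<close>, hence the 2, which is harmless for summability.\<close>

lemma (in prob_space) nn_integral_powr_le_of_square:
  fixes f :: "'a \<Rightarrow> real"
  assumes [measurable]: "f \<in> borel_measurable M" and f: "\<And>\<omega>. 0 \<le> f \<omega>" and p: "0 < p" "p \<le> 2" and s: "0 \<le> s"
    and le: "(\<integral>\<^sup>+\<omega>. ennreal ((f \<omega>)\<^sup>2) \<partial>M) \<le> ennreal (s\<^sup>2)"
  shows "(\<integral>\<^sup>+\<omega>. ennreal (f \<omega> powr p) \<partial>M) \<le> ennreal (2 * s powr p)"
proof (cases "s = 0")
  \<comment> \<open>Treated apart because \<open>0 powr (p - 2)\<close> is 0, so the pointwise bound
    fails at \<open>s = 0\<close>.\<close>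
  case True
  then have "(\<integral>\<^sup>+\<omega>. ennreal ((f \<omega>)\<^sup>2) \<partial>M) = 0" using le by simp
  then have "AE \<omega> in M. f \<omega> = 0" by (subst (asm) nn_integral_0_iff_AE) (auto simp: ennreal_eq_0_iff)
  then have "AE \<omega> in M. ennreal (f \<omega> powr p) = 0" by eventually_elim simp
  then have "(\<integral>\<^sup>+\<omega>. ennreal (f \<omega> powr p) \<partial>M) = 0" by (subst nn_integral_0_iff_AE) auto
  then show ?thesis by simp
next
  case False
  then have s0: "0 < s" using s by simp
  have pw: "f \<omega> powr p \<le> s powr p + s powr (p - 2) * (f \<omega>)\<^sup>2" for \<omega>
  proof (cases "f \<omega> \<le> s")
    case True
    then show ?thesis using powr_mono2[of p "f \<omega>" s] f p s0 by (simp add: add_increasing2)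
  next
    case False
    then have "f \<omega> powr p = f \<omega> powr (p - 2) * (f \<omega>)\<^sup>2"
      using s0 by (simp add: powr_diff)
    also have "\<dots> \<le> s powr (p - 2) * (f \<omega>)\<^sup>2"
      using False s0 p by (intro mult_right_mono powr_mono2') auto
    finally show ?thesis using powr_ge_zero[of s p] by linarith
  qed
  have "(\<integral>\<^sup>+\<omega>. ennreal (f \<omega> powr p) \<partial>M) \<le> (\<integral>\<^sup>+\<omega>. ennreal (s powr p) + ennreal (s powr (p - 2)) * ennreal ((f \<omega>)\<^sup>2) \<partial>M)"
    using pw by (intro nn_integral_mono) (simp add: ennreal_plus[symmetric] ennreal_mult[symmetric] ennreal_leI del: ennreal_plus)
  also have "\<dots> = ennreal (s powr p) + ennreal (s powr (p - 2)) * (\<integral>\<^sup>+\<omega>. ennreal ((f \<omega>)\<^sup>2) \<partial>M)"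
    by (simp add: nn_integral_add nn_integral_cmult emeasure_space_1)
  also have "\<dots> \<le> ennreal (s powr p) + ennreal (s powr (p - 2)) * ennreal (s\<^sup>2)"
    by (intro add_left_mono mult_left_mono le) simp
  also have "\<dots> = ennreal (2 * s powr p)"
    using s0 by (simp add: ennreal_mult[symmetric] ennreal_plus[symmetric] powr_diff del: ennreal_plus)
  finally show ?thesis .
qed

lemma AE_summable_of_nn_integral:
  fixes f :: "nat \<Rightarrow> 'a \<Rightarrow> real"
  assumes [measurable]: "\<And>n. f n \<in> borel_measurable M" and f: "\<And>n \<omega>. 0 \<le> f n \<omega>"
    and le: "\<And>n. (\<integral>\<^sup>+\<omega>. ennreal (f n \<omega>) \<partial>M) \<le> ennreal (b n)" and b: "\<And>n. 0 \<le> b n" "summable b"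
  shows "AE \<omega> in M. summable (\<lambda>n. f n \<omega>)"
proof -
  have "(\<integral>\<^sup>+\<omega>. (\<Sum>n. ennreal (f n \<omega>)) \<partial>M) = (\<Sum>n. \<integral>\<^sup>+\<omega>. ennreal (f n \<omega>) \<partial>M)"
    by (rule nn_integral_suminf) simp
  also have "\<dots> \<le> (\<Sum>n. ennreal (b n))" by (intro suminf_le le) auto
  also have "\<dots> < \<infinity>" using b by (simp add: suminf_ennreal2)
  finally have "AE \<omega> in M. (\<Sum>n. ennreal (f n \<omega>)) \<noteq> \<infinity>" by (intro nn_integral_PInf_AE) auto
  then show ?thesis by eventually_elim (rule summable_suminf_not_top[OF f], simp)
qed

lemma sigma_upto_mono: "subalgebra (sigma_upto M Z (Suc n)) (sigma_upto M Z n)"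
proof -
  have "sets (sigma_upto M Z n) \<subseteq> sets (sigma_upto M Z (Suc n))"
    unfolding sigma_upto_def
    by (subst (1 2) sets_measure_of) (auto intro!: sigma_sets_mono' intro: le_SucI)
  then show ?thesis by (simp add: subalgebra_def)
qed

lemma truncated_measurable:
  fixes Z :: "nat \<Rightarrow> 'a \<Rightarrow> 'b::real_normed_vector"
  shows "truncated M \<alpha> Z n \<in> borel_measurable (sigma_upto M Z (Suc n))"
proof -
  have Z: "Z (Suc n) \<in> borel_measurable (sigma_upto M Z (Suc n))" by (rule measurable_sigma_upto) simp
  have [measurable]: "(\<lambda>\<omega>. norm (\<alpha> n *\<^sub>R Z (Suc n) \<omega>)) \<in> borel_measurable (sigma_upto M Z (Suc n))"
    by (rule measurable_compose[OF Z, of "\<lambda>z. norm (\<alpha> n *\<^sub>R z)"])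
      (intro borel_measurable_continuous_onI continuous_intros)
  \<comment> \<open>Truncation as a case distinction keeps Borel measurability without a product of
    measurable functions, which could require separability.\<close>
  have "(\<lambda>\<omega>. if norm (\<alpha> n *\<^sub>R Z (Suc n) \<omega>) < 1 then Z (Suc n) \<omega> else 0)
      \<in> borel_measurable (sigma_upto M Z (Suc n))"
    by (intro measurable_If Z) measurable
  then show ?thesis
    by (subst measurable_cong) (auto simp: truncated_def indicator_def)
qed

section \<open>Almost sure convergence of the scheme\<close>

theorem theorem3:
  fixes M :: "'a measure"
    and p \<rho> \<theta> C :: real
    and G :: "'b::banach \<Rightarrow> 'b" and x_star y0 :: 'b
    and lam :: "nat \<Rightarrow> (nat \<Rightarrow> 'b) \<Rightarrow> real"
    and \<alpha> \<mu> \<sigma> :: "nat \<Rightarrow> real"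
    and Z Zbar Y :: "nat \<Rightarrow> 'a \<Rightarrow> 'b"
  assumes "prob_space M"
    and "uniformly_smooth p TYPE('b)"
    and "G x_star = 0" and "\<And>x. G x = 0 \<Longrightarrow> x = x_star"
    and "0 < \<rho>" "\<rho> < 1" "1 \<le> \<theta>"
    and "\<And>x. norm ((1 / \<theta>) *\<^sub>R G x - (x - x_star)) \<le> \<rho> * norm (x - x_star)"
    and "\<And>n u. u \<in> {..n} \<rightarrow>\<^sub>E UNIV \<Longrightarrow>
           \<bar>lam n u\<bar> \<le> C * (1 + Max ((\<lambda>k. norm (u k)) ` {..n}))"
    and "\<And>n. 0 < \<alpha> n" "\<And>n. \<alpha> n < 1" "\<alpha> \<longlonglongrightarrow> 0" "\<not> summable \<alpha>"
    and "\<And>n. Z n \<in> borel_measurable M"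
    and "summable (\<lambda>n. measure M {\<omega>\<in>space M. norm (\<alpha> n *\<^sub>R Z (Suc n) \<omega>) \<ge> 1})"
    and "\<And>n. is_cond_exp M (sigma_upto M Z n) (truncated M \<alpha> Z n) (Zbar (Suc n))"
    and "\<And>n. 0 \<le> \<mu> n" "\<And>n. 0 \<le> \<sigma> n"
    and "\<And>n. (\<integral>\<^sup>+\<omega>. ennreal (norm (Zbar (Suc n) \<omega>)) \<partial>M) \<le> ennreal (\<mu> n)"
    and "\<And>n. (\<integral>\<^sup>+\<omega>. ennreal ((norm (truncated M \<alpha> Z n \<omega> - Zbar (Suc n) \<omega>))\<^sup>2) \<partial>M)
           \<le> ennreal ((\<sigma> n)\<^sup>2)"
    and "summable (\<lambda>n. \<alpha> n * \<mu> n)"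
    and "summable (\<lambda>n. \<alpha> n powr p * \<sigma> n powr p)"
    and "\<And>\<omega>. \<omega> \<in> space M \<Longrightarrow> Y 0 \<omega> = y0"
    and "\<And>n \<omega>. \<omega> \<in> space M \<Longrightarrow> Y (Suc n) \<omega> =
           Y n \<omega> - \<alpha> n *\<^sub>R (G (Y n \<omega>) + lam n (\<lambda>k\<in>{..n}. Y k \<omega>) *\<^sub>R Z (Suc n) \<omega>)"
    and "\<And>n. (\<lambda>\<omega>. lam n (\<lambda>k\<in>{..n}. Y k \<omega>)) \<in> borel_measurable (sigma_upto M Z n)"
  shows "AE \<omega> in M. (\<lambda>n. Y (Suc n) \<omega>) \<longlonglongrightarrow> x_star"
proof -
  interpret prob_space M by fact
  note rho = assms(5-7) and G = assms(8) and lam = assms(9) and alpha = assms(10-13)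
    and Z = assms(14) and tails = assms(15) and ce = assms(16) and mu = assms(17) and sigma = assms(18)
    and Zbar_le = assms(19) and var_le = assms(20) and sum_mu = assms(21) and sum_sigma = assms(22)
    and Y_Suc = assms(24) and lam_meas = assms(25)
  obtain D where p: "1 < p" "p \<le> 2" and D: "0 < D"
    and smooth: "\<And>x y :: 'b. norm (x + y) powr p + norm (x - y) powr p \<le> 2 * norm x powr p + D * norm y powr p"
    using assms(2) unfolding uniformly_smooth_def by blast
  define F where "F n = sigma_upto M Z n" for n
  have F: "subalgebra M (F n)" for n using ce[of n] by (simp add: is_cond_exp_def F_def)
  have F_Suc: "subalgebra (F (Suc n)) (F n)" for n unfolding F_def by (rule sigma_upto_mono)
  \<comment> \<open>The versions are chosen at their own times, n + 1 for the truncated noise and n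
    for its conditional mean, so that their difference is a strongly measurable increment of the
    filtration.\<close>
  have "\<forall>n. \<exists>X' W'. strongly_measurable (F (Suc n)) X' \<and> (AE \<omega> in M. X' \<omega> = truncated M \<alpha> Z n \<omega>)
      \<and> strongly_measurable (F n) W' \<and> (AE \<omega> in M. W' \<omega> = Zbar (Suc n) \<omega>)"
  proof
    fix n
    obtain X' W' where "strongly_measurable (F (Suc n)) X'" "AE \<omega> in M. X' \<omega> = truncated M \<alpha> Z n \<omega>"
      "strongly_measurable (F n) W'" "AE \<omega> in M. W' \<omega> = Zbar (Suc n) \<omega>"
      using cond_exp_modifications[OF ce[of n, folded F_def] F truncated_measurable[of M \<alpha> Z n, folded F_def]] .
    then show "\<exists>X' W'. strongly_measurable (F (Suc n)) X' \<and> (AE \<omega> in M. X' \<omega> = truncated M \<alpha> Z n \<omega>)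
      \<and> strongly_measurable (F n) W' \<and> (AE \<omega> in M. W' \<omega> = Zbar (Suc n) \<omega>)" by blast
  qed
  from choice[OF this] obtain X where "\<forall>n. \<exists>W'. strongly_measurable (F (Suc n)) (X n) \<and> (AE \<omega> in M. X n \<omega> = truncated M \<alpha> Z n \<omega>)
      \<and> strongly_measurable (F n) W' \<and> (AE \<omega> in M. W' \<omega> = Zbar (Suc n) \<omega>)" ..
  from choice[OF this] obtain W where XW: "strongly_measurable (F (Suc n)) (X n)"
    "AE \<omega> in M. X n \<omega> = truncated M \<alpha> Z n \<omega>" "strongly_measurable (F n) (W n)"
    "AE \<omega> in M. W n \<omega> = Zbar (Suc n) \<omega>" for n by blast
  note XM = strongly_measurable_subalgebra[OF F XW(1)] and WM = strongly_measurable_subalgebra[OF F XW(3)]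
  \<comment> \<open>The step size is built into the increment, so that the summability hypothesis
    becomes \<open>summable \<tau>\<close> up to the factor 2 from the passage from second to p-th
    moments.\<close>
  define \<xi> where "\<xi> n \<omega> = \<alpha> n *\<^sub>R (X n \<omega> - W n \<omega>)" for n \<omega>

  interpret noise: centered_noise M F \<xi> p D "\<lambda>n. 2 * (\<alpha> n powr p * \<sigma> n powr p)"
  proof unfold_locales
    show "1 < p" "0 \<le> D" using p D by auto
    show "norm (x + y) powr p + norm (x - y) powr p \<le> 2 * norm x powr p + D * norm y powr p" for x y :: 'b
      by (rule smooth)
    show "subalgebra M (F n)" "subalgebra (F (Suc n)) (F n)" for n by (rule F F_Suc)+
    show "strongly_measurable (F (Suc n)) (\<xi> n)" for n
      unfolding \<xi>_def
      by (intro strongly_measurable_scaleR strongly_measurable_diff XW(1)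
          strongly_measurable_subalgebra[OF F_Suc XW(3)]) simp
    have cc: "conditionally_centered M (F n) (\<lambda>\<omega>. X n \<omega> - W n \<omega>)" for n
      by (rule conditionally_centered_cond_exp[OF ce[of n, folded F_def] XM XW(2) WM XW(4)])
    show "conditionally_centered M (F n) (\<xi> n)" for n
      unfolding conditionally_centered_def \<xi>_def
      using conditionally_centered_scaleR[OF cc F strongly_measurable_diff[OF XM WM]] by blast
    show "(\<integral>\<^sup>+\<omega>. ennreal (norm (\<xi> n \<omega>) powr p) \<partial>M) \<le> ennreal (2 * (\<alpha> n powr p * \<sigma> n powr p))" for n
    proof -
      have [measurable]: "(\<lambda>\<omega>. norm (X n \<omega> - W n \<omega>)) \<in> borel_measurable M"
        by (intro strongly_measurable_norm strongly_measurable_diff XM WM)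
      have "(\<integral>\<^sup>+\<omega>. ennreal ((norm (X n \<omega> - W n \<omega>))\<^sup>2) \<partial>M)
          = (\<integral>\<^sup>+\<omega>. ennreal ((norm (truncated M \<alpha> Z n \<omega> - Zbar (Suc n) \<omega>))\<^sup>2) \<partial>M)"
      proof (rule nn_integral_cong_AE)
        show "AE \<omega> in M. ennreal ((norm (X n \<omega> - W n \<omega>))\<^sup>2)
            = ennreal ((norm (truncated M \<alpha> Z n \<omega> - Zbar (Suc n) \<omega>))\<^sup>2)"
          using XW(2)[of n] XW(4)[of n] by eventually_elim simp
      qed
      then have "(\<integral>\<^sup>+\<omega>. ennreal (norm (X n \<omega> - W n \<omega>) powr p) \<partial>M) \<le> ennreal (2 * \<sigma> n powr p)"
        using var_le[of n] p sigma[of n] by (intro nn_integral_powr_le_of_square) auto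
      then have "ennreal (\<alpha> n powr p) * (\<integral>\<^sup>+\<omega>. ennreal (norm (X n \<omega> - W n \<omega>) powr p) \<partial>M)
          \<le> ennreal (\<alpha> n powr p) * ennreal (2 * \<sigma> n powr p)"
        by (rule mult_left_mono) simp
      also have "ennreal (\<alpha> n powr p) * (\<integral>\<^sup>+\<omega>. ennreal (norm (X n \<omega> - W n \<omega>) powr p) \<partial>M)
          = (\<integral>\<^sup>+\<omega>. ennreal (norm (\<xi> n \<omega>) powr p) \<partial>M)"
        using alpha(1)[of n] by (simp add: \<xi>_def powr_mult nn_integral_cmult[symmetric] ennreal_mult)
      also have "ennreal (\<alpha> n powr p) * ennreal (2 * \<sigma> n powr p) = ennreal (2 * (\<alpha> n powr p * \<sigma> n powr p))"
        by (simp add: ennreal_mult[symmetric] ac_simps)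
      finally show ?thesis .
    qed
    show "summable (\<lambda>n. 2 * (\<alpha> n powr p * \<sigma> n powr p))" using sum_sigma by (rule summable_mult)
  qed simp

  define l where "l n \<omega> = lam n (\<lambda>k\<in>{..n}. Y k \<omega>)" for n \<omega>
  \<comment> \<open>The floor 1 keeps the division safe, so
    \<open>\<Lambda> n \<omega> * c n \<omega> = l n \<omega>\<close> always. The index n is
    included in the maximum; both factors are known at time n, hence \<open>c n\<close> is
    predictable.\<close>
  define \<Lambda> where "\<Lambda> n \<omega> = max 1 (Max ((\<lambda>k. \<bar>l k \<omega>\<bar>) ` {..n}))" for n \<omega>
  define c where "c n \<omega> = l n \<omega> / \<Lambda> n \<omega>" for n \<omega>
  have Lam_ge: "1 \<le> \<Lambda> n \<omega>" "\<bar>l n \<omega>\<bar> \<le> \<Lambda> n \<omega>" for n \<omega>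
    unfolding \<Lambda>_def by (auto intro!: max.coboundedI2 Max_ge)
  have c1: "\<bar>c n \<omega>\<bar> \<le> 1" for n \<omega> using Lam_ge[of n \<omega>] by (simp add: c_def)
  have c_meas: "c n \<in> borel_measurable (F n)" for n
  proof -
    have [measurable]: "l k \<in> borel_measurable (F n)" if "k \<in> {..n}" for k
      using lam_meas[of k] measurable_from_subalg[OF noise.subalgebra_filtration[of k n]] that
      unfolding l_def F_def by auto
    have [measurable]: "(\<lambda>\<omega>. Max ((\<lambda>k. \<bar>l k \<omega>\<bar>) ` {..n})) \<in> borel_measurable (F n)"
      by (intro borel_measurable_Max borel_measurable_abs) auto
    show ?thesis unfolding c_def \<Lambda>_def by measurable
  qed

  have ae_noise: "AE \<omega> in M. summable (\<lambda>k. c k \<omega> *\<^sub>R \<xi> k \<omega>)"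
    by (rule noise.transform_AE_summable[OF c_meas c1])
  have ae_mean: "AE \<omega> in M. summable (\<lambda>n. \<alpha> n * norm (W n \<omega>))"
  proof (rule AE_summable_of_nn_integral[where b = "\<lambda>n. \<alpha> n * \<mu> n"])
    have m: "(\<lambda>\<omega>. norm (W n \<omega>)) \<in> borel_measurable M" for n by (rule strongly_measurable_norm[OF WM])
    show "(\<lambda>\<omega>. \<alpha> n * norm (W n \<omega>)) \<in> borel_measurable M" for n using m by measurable
    show "0 \<le> \<alpha> n * norm (W n \<omega>)" "0 \<le> \<alpha> n * \<mu> n" for n \<omega>
      using alpha(1)[of n] mu[of n] by simp_all
    show "summable (\<lambda>n. \<alpha> n * \<mu> n)" by (rule sum_mu)
    show "(\<integral>\<^sup>+\<omega>. ennreal (\<alpha> n * norm (W n \<omega>)) \<partial>M) \<le> ennreal (\<alpha> n * \<mu> n)" for n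
    proof -
      have "(\<integral>\<^sup>+\<omega>. ennreal (norm (W n \<omega>)) \<partial>M) = (\<integral>\<^sup>+\<omega>. ennreal (norm (Zbar (Suc n) \<omega>)) \<partial>M)"
      proof (rule nn_integral_cong_AE)
        show "AE \<omega> in M. ennreal (norm (W n \<omega>)) = ennreal (norm (Zbar (Suc n) \<omega>))"
          using XW(4)[of n] by eventually_elim simp
      qed
      then have "ennreal (\<alpha> n) * (\<integral>\<^sup>+\<omega>. ennreal (norm (W n \<omega>)) \<partial>M) \<le> ennreal (\<alpha> n) * ennreal (\<mu> n)"
        using Zbar_le[of n] by (intro mult_left_mono) auto
      then show ?thesis
        using alpha(1)[of n] mu[of n] m[of n] by (simp add: ennreal_mult nn_integral_cmult)
    qed
  qed
  have ae_trunc: "AE \<omega> in M. \<forall>n. X n \<omega> = truncated M \<alpha> Z n \<omega>"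
    using XW(2) by (simp add: AE_all_countable)
  have ae_tail: "AE \<omega> in M. \<forall>\<^sub>F n in sequentially. norm (\<alpha> n *\<^sub>R Z (Suc n) \<omega>) < 1"
  proof -
    have "AE \<omega> in M. \<forall>\<^sub>F n in sequentially. \<omega> \<in> space M - {\<omega>\<in>space M. norm (\<alpha> n *\<^sub>R Z (Suc n) \<omega>) \<ge> 1}"
    proof (rule borel_cantelli_AE1)
      show "{\<omega>\<in>space M. norm (\<alpha> n *\<^sub>R Z (Suc n) \<omega>) \<ge> 1} \<in> sets M" for n
      proof -
        have [measurable]: "(\<lambda>\<omega>. norm (\<alpha> n *\<^sub>R Z (Suc n) \<omega>)) \<in> borel_measurable M"
          by (rule measurable_compose[OF Z, of "\<lambda>z. norm (\<alpha> n *\<^sub>R z)"])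
            (intro borel_measurable_continuous_onI continuous_intros)
        show ?thesis by measurable
      qed
    qed (use tails in \<open>auto simp: less_top[symmetric]\<close>)
    then show ?thesis by eventually_elim (auto elim!: eventually_mono)
  qed

  have "AE \<omega> in M. (\<lambda>n. Y n \<omega> - x_star) \<longlonglongrightarrow> 0"
    using ae_noise ae_mean ae_trunc ae_tail AE_space
  proof eventually_elim
    case (elim \<omega>)
    have w: "summable (\<lambda>n. (\<alpha> n * c n \<omega>) *\<^sub>R Z (Suc n) \<omega>)"
    proof -
      have "summable (\<lambda>n. (\<alpha> n * c n \<omega>) *\<^sub>R W n \<omega>)"
      proof (rule summable_comparison_test'[OF elim(2)])
        fix n
        show "norm ((\<alpha> n * c n \<omega>) *\<^sub>R W n \<omega>) \<le> \<alpha> n * norm (W n \<omega>)"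
          using alpha(1)[of n] mult_right_mono[OF c1[of n \<omega>], of "\<alpha> n * norm (W n \<omega>)"]
          by (simp add: abs_mult mult_ac)
      qed
      from summable_add[OF elim(1) this]
      have X: "summable (\<lambda>n. (\<alpha> n * c n \<omega>) *\<^sub>R X n \<omega>)" by (simp add: \<xi>_def algebra_simps)
      \<comment> \<open>On this path the truncation is eventually inactive, so the two series differ
        in finitely many terms.\<close>
      have "\<forall>\<^sub>F n in sequentially. (\<alpha> n * c n \<omega>) *\<^sub>R X n \<omega> = (\<alpha> n * c n \<omega>) *\<^sub>R Z (Suc n) \<omega>"
        using elim(4) by eventually_elim (use elim in \<open>simp add: truncated_def\<close>)
      from summable_cong[OF this] show ?thesis using X by simp
    qed
    show ?case
    \<comment> \<open>Rescaling by \<theta>: with drift \<open>(1 / \<theta>) *\<^sub>R G\<close>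
      and steps \<open>\<theta> * \<alpha> n\<close> the hypothesis on \<open>G\<close> says that
      the drift is close to the identity in \<open>Y n \<omega> - x_star\<close>. These steps may
      exceed 1 at first.\<close>
    proof (rule stochastic_approximation_pathwise[OF _ _ _ _ _ _ _ _ _ _ w])
      show "0 < \<rho>" "\<rho> < 1" by fact+
      show "0 < \<theta> * \<alpha> n" for n using rho alpha(1)[of n] by simp
      show "(\<lambda>n. \<theta> * \<alpha> n) \<longlonglongrightarrow> 0" using tendsto_mult_right_zero[OF alpha(3)] .
      show "\<not> summable (\<lambda>n. \<theta> * \<alpha> n)"
      proof
        assume "summable (\<lambda>n. \<theta> * \<alpha> n)"
        from summable_mult[OF this, of "1 / \<theta>"] show False using alpha(4) rho by simp
      qed
      show "norm ((1 / \<theta>) *\<^sub>R G (Y n \<omega>) - (Y n \<omega> - x_star)) \<le> \<rho> * norm (Y n \<omega> - x_star)" for n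
        by (rule G)
      show "Y (Suc n) \<omega> - x_star = Y n \<omega> - x_star - (\<theta> * \<alpha> n) *\<^sub>R ((1 / \<theta>) *\<^sub>R G (Y n \<omega>))
          - \<Lambda> n \<omega> *\<^sub>R ((\<alpha> n * c n \<omega>) *\<^sub>R Z (Suc n) \<omega>)" for n
        using rho Lam_ge(1)[of n \<omega>] Y_Suc[OF elim(5), of n, folded l_def]
        by (simp add: c_def scaleR_add_right)
      show "0 \<le> \<Lambda> n \<omega>" for n using Lam_ge(1)[of n \<omega>] by simp
      show "mono (\<lambda>n. \<Lambda> n \<omega>)"
        unfolding \<Lambda>_def by (intro monoI max.mono Max_mono) auto
      \<comment> \<open>The summand 1 accounts for the floor in \<open>\<Lambda>\<close>. The factor
        \<open>1 + norm x_star\<close> recenters the growth bound: 1 + norm x_star + m \<le> (1 +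
        norm x_star) * (1 + m), where m is the maximal error norm.\<close>
      show "\<Lambda> n \<omega> \<le> (1 + \<bar>C\<bar> * (1 + norm x_star)) * (1 + Max ((\<lambda>k. norm (Y k \<omega> - x_star)) ` {..n}))" for n
      proof -
        define m where "m = Max ((\<lambda>k. norm (Y k \<omega> - x_star)) ` {..n})"
        have m: "norm (Y k \<omega> - x_star) \<le> m" if "k \<le> n" for k
          unfolding m_def using that by (intro Max_ge) auto
        have m0: "0 \<le> m" using m[of 0] norm_ge_zero order_trans by blast
        have "\<bar>l k \<omega>\<bar> \<le> \<bar>C\<bar> * (1 + norm x_star) * (1 + m)" if "k \<le> n" for k
        proof -
          define y where "y = Max ((\<lambda>j. norm ((\<lambda>j\<in>{..k}. Y j \<omega>) j)) ` {..k})"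
          have y: "y \<le> norm x_star + m"
            unfolding y_def
          proof (subst Max_le_iff; clarsimp)
            fix j assume "j \<le> k"
            then show "norm (Y j \<omega>) \<le> norm x_star + m"
              using m[of j] that norm_triangle_sub[of "Y j \<omega>" x_star] by simp
          qed
          have y0: "0 \<le> y" unfolding y_def by (subst Max_ge_iff) auto
          have "\<bar>l k \<omega>\<bar> \<le> C * (1 + y)" unfolding l_def y_def by (rule lam) simp
          also have "\<dots> \<le> \<bar>C\<bar> * (1 + y)" using y0 by (intro mult_right_mono) auto
          also have "\<dots> \<le> \<bar>C\<bar> * ((1 + norm x_star) * (1 + m))"
            using y mult_nonneg_nonneg[OF m0 norm_ge_zero[of x_star]]
            by (intro mult_left_mono) (auto simp: algebra_simps)
          finally show ?thesis by (simp add: mult.assoc)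
        qed
        then have "Max ((\<lambda>k. \<bar>l k \<omega>\<bar>) ` {..n}) \<le> \<bar>C\<bar> * (1 + norm x_star) * (1 + m)"
          by (subst Max_le_iff) auto
        moreover have "0 \<le> \<bar>C\<bar> * (1 + norm x_star) * (1 + m)" using m0 by simp
        ultimately have "\<Lambda> n \<omega> \<le> (1 + m) + \<bar>C\<bar> * (1 + norm x_star) * (1 + m)"
          unfolding \<Lambda>_def using m0 by linarith
        then show ?thesis unfolding m_def[symmetric] by (simp add: distrib_right)
      qed
    qed
  qed
  then show ?thesis
  proof eventually_elim
    case (elim \<omega>)
    then have "(\<lambda>n. Y n \<omega>) \<longlonglongrightarrow> x_star" by (rule LIM_zero_cancel)
    then show ?case by (rule LIMSEQ_Suc)
  qed
qed

end
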